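(* With $S_1,S_2,S_3,S_4$ as defined in the context, we have $$S_1(q)=(-q^3;q^3)_\infty\, S_3(q), \qquad S_2(q)=(-q^3;q^3)_\infty\, S_4(q).$$
   Context: Let $|q|<1$ and use standard $q$-Pochhammer notation $(a;q)_n=\prod_{k=0}^{n-1}(1-aq^k)$, $(a;q)_\infty=\prod_{k\ge0}(1-aq^k)$. Define $$S_1(q)=\sum_{i,j\geq 0}\frac{q^{\frac{1}{2}i^2-ij+2j^2-\frac{1}{2}i+2j}}{(q^3;q^3)_i(q^3;q^3)_j},\qquad S_2(q)=\sum_{i,j\geq 0}\frac{q^{\frac{1}{2}i^2-ij+2j^2+\frac{3}{2}i}}{(q^3;q^3)_i (q^3;q^3)_j},$$ $$S_3(q)=\sum_{i,j\geq 0} \frac{q^{2i^2+2ij+2j^2-2i-j}}{(q^3;q^3)_i(q^3;q^3)_j},\qquad S_4(q)=\sum_{i,j\geq 0} \frac{q^{2i^2+2ij+2j^2}}{(q^3;q^3)_i(q^3;q^3)_j}.$$ (All exponents of $q$ are integers.) *)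

theory Defs
  imports "HOL-Analysis.Analysis"
begin

definition qpoch :: "complex \<Rightarrow> complex \<Rightarrow> nat \<Rightarrow> complex" where
  "qpoch a q n = (\<Prod>k<n. 1 - a * q ^ k)"

definition qpoch_inf :: "complex \<Rightarrow> complex \<Rightarrow> complex" where
  "qpoch_inf a q = (\<Prod>k. 1 - a * q ^ k)"

text \<open>The exponents are integers; half-integer parts are written with exact integer division.\<close>
definition S1 :: "complex \<Rightarrow> complex" where
  "S1 q = (\<Sum>\<^sub>\<infinity>(i,j)\<in>(UNIV :: (nat \<times> nat) set).
     q powi ((int i * int i - int i) div 2 - int i * int j + 2 * int j * int j + 2 * int j)
     / (qpoch (q^3) (q^3) i * qpoch (q^3) (q^3) j))"

definition S2 :: "complex \<Rightarrow> complex" where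
  "S2 q = (\<Sum>\<^sub>\<infinity>(i,j)\<in>(UNIV :: (nat \<times> nat) set).
     q powi ((int i * int i + 3 * int i) div 2 - int i * int j + 2 * int j * int j)
     / (qpoch (q^3) (q^3) i * qpoch (q^3) (q^3) j))"

definition S3 :: "complex \<Rightarrow> complex" where
  "S3 q = (\<Sum>\<^sub>\<infinity>(i,j)\<in>(UNIV :: (nat \<times> nat) set).
     q powi (2 * int i * int i + 2 * int i * int j + 2 * int j * int j - 2 * int i - int j)
     / (qpoch (q^3) (q^3) i * qpoch (q^3) (q^3) j))"

definition S4 :: "complex \<Rightarrow> complex" where
  "S4 q = (\<Sum>\<^sub>\<infinity>(i,j)\<in>(UNIV :: (nat \<times> nat) set).
     q powi (2 * int i * int i + 2 * int i * int j + 2 * int j * int j)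
     / (qpoch (q^3) (q^3) i * qpoch (q^3) (q^3) j))"

end

theory Submission
  imports Defs
begin

text \<open>
  Write \<open>q = u\<^sup>2\<close>, \<open>s = u\<^sup>3\<close>, \<open>p = s\<^sup>2 = q\<^sup>3\<close>, and let \<open>e = 1\<close> for the identity between \<open>S\<^sub>2\<close> and \<open>S\<^sub>4\<close>,
  \<open>e = 0\<close> for the one between \<open>S\<^sub>1\<close> and \<open>S\<^sub>3\<close>. Grouping \<open>S\<^sub>1, S\<^sub>2\<close> by \<open>n = i - j\<close>
  and \<open>S\<^sub>3, S\<^sub>4\<close> by \<open>n = i + 2 j\<close>, the base \<open>q\<close> enters only through the theta weight \<open>w(n) = u\<^bsup>n n - (1 - e) n\<^esup>\<close>, so both
  sides are linear functionals of \<open>w\<close> with coefficients in base \<open>p\<close>. For the different weight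
  \<open>T(n) = \<Sum> s\<^bsup>a a + e a + b (b - 1) / 2\<^esup>\<close>, summed over the integers \<open>a + b = n\<close>, both functionals can be
  evaluated by Euler's expansions: each gives a product times the Rogers-Ramanujan series
  \<open>\<Sum> s\<^bsup>m m + e m\<^esup> / (s; s)\<^sub>m\<close>, reached on one side through Rogers's series with denominators
  \<open>(s\<^sup>4; s\<^sup>4)\<^sub>k\<close>, and the products agree by Gauss's theta identity. Now \<open>T\<close> and \<open>w\<close> have the same
  quasi-period 3 and the same reflection symmetry, so \<open>T\<close> is a multiple of \<open>w\<close> on the residue class fixed
  by the reflection and another multiple of \<open>w\<close> on the other two classes. Changing the sign of \<open>u\<close>
  gives a second such weight, independent of the first because the generating function of
  \<open>T\<close> vanishes at a point where that of the second weight does not. Hence the identity holds on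
  each class, and therefore for \<open>w\<close> itself.
\<close>

subsection \<open>Pochhammer symbols\<close>

definition qinv :: "complex \<Rightarrow> nat \<Rightarrow> complex" where
  "qinv q n = inverse (qpoch q q n)"

lemma qpoch_0 [simp]: "qpoch a q 0 = 1"
  by (simp add: qpoch_def)

lemma qpoch_Suc: "qpoch a q (Suc n) = qpoch a q n * (1 - a * q ^ n)"
  by (simp add: qpoch_def)

lemma qpoch_shift: "qpoch a q (m + n) = qpoch a q m * qpoch (a * q ^ m) q n"
  by (induction n) (simp_all add: qpoch_Suc power_add algebra_simps)

lemma norm_power_Suc_less_1:
  fixes q :: complex
  assumes "norm q < 1"
  shows "norm (q ^ Suc k) < 1"
  unfolding norm_power using power_Suc_less_one[of "norm q" k] assms by (cases "q = 0") auto

lemma power_Suc_neq_1: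
  fixes q :: complex
  assumes "norm q < 1"
  shows "q ^ Suc k \<noteq> 1"
  using norm_power_Suc_less_1[OF assms, of k] by (metis norm_one less_irrefl)

lemma qpoch_nonzero: "norm q < 1 \<Longrightarrow> qpoch q q n \<noteq> 0"
  using power_Suc_neq_1[of q] by (auto simp: qpoch_def)

lemma qpoch_mult_qinv: "norm q < 1 \<Longrightarrow> qpoch q q n * qinv q n = 1"
  using qpoch_nonzero[of q n] by (simp add: qinv_def)

lemma qinv_0 [simp]: "qinv q 0 = 1"
  by (simp add: qinv_def)

lemma qinv_Suc: "norm q < 1 \<Longrightarrow> (1 - q ^ Suc n) * qinv q (Suc n) = qinv q n"
  using power_Suc_neq_1[of q n] by (simp add: qinv_def qpoch_Suc)

lemma convergent_prod_qpoch:
  fixes a q :: complex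
  assumes "norm q < 1"
  shows "convergent_prod (\<lambda>k. 1 - a * q ^ k)"
proof (rule abs_convergent_prod_imp_convergent_prod)
  have "summable (\<lambda>k. norm a * norm q ^ k)"
    using assms by (intro summable_mult summable_geometric) auto
  then show "abs_convergent_prod (\<lambda>k. 1 - a * q ^ k)"
    by (simp add: abs_convergent_prod_conv_summable norm_mult norm_power)
qed

lemma qpoch_LIMSEQ:
  assumes "norm q < 1"
  shows "(\<lambda>n. qpoch a q n) \<longlonglongrightarrow> qpoch_inf a q"
proof -
  have "(\<lambda>n. qpoch a q (Suc n)) \<longlonglongrightarrow> qpoch_inf a q"
    using convergent_prod_LIMSEQ[OF convergent_prod_qpoch[OF assms, of a]]
    by (simp add: qpoch_def qpoch_inf_def lessThan_Suc_atMost)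
  then show ?thesis by (rule LIMSEQ_imp_Suc)
qed

lemma qpoch_inf_split:
  assumes "norm q < 1"
  shows "qpoch_inf a q = qpoch a q m * qpoch_inf (a * q ^ m) q"
proof (rule LIMSEQ_unique)
  show "(\<lambda>n. qpoch a q (m + n)) \<longlonglongrightarrow> qpoch_inf a q"
    using LIMSEQ_ignore_initial_segment[OF qpoch_LIMSEQ[OF assms, of a], of m]
    by (simp add: add.commute)
  show "(\<lambda>n. qpoch a q (m + n)) \<longlonglongrightarrow> qpoch a q m * qpoch_inf (a * q ^ m) q"
    unfolding qpoch_shift by (intro tendsto_intros qpoch_LIMSEQ assms)
qed

lemma qpoch_inf_head: "norm q < 1 \<Longrightarrow> qpoch_inf a q = (1 - a) * qpoch_inf (a * q) q"
  using qpoch_inf_split[of q a 1] by (simp add: qpoch_Suc)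

lemma qpoch_inf_nonzero:
  assumes "norm q < 1" "\<And>k. a * q ^ k \<noteq> 1"
  shows "qpoch_inf a q \<noteq> 0"
proof -
  have "1 - a * q ^ k \<noteq> 0" for k using assms(2)[of k] by auto
  then show ?thesis
    unfolding qpoch_inf_def by (intro prodinf_nonzero convergent_prod_qpoch assms(1))
qed

lemma qpoch_inf_nonzero':
  assumes "norm q < 1" "norm a < 1"
  shows "qpoch_inf a q \<noteq> 0"
proof (rule qpoch_inf_nonzero[OF assms(1)])
  fix k
  have "norm (a * q ^ k) \<le> norm a * 1"
    unfolding norm_mult norm_power using assms by (intro mult_left_mono power_le_one) auto
  also have "\<dots> < 1" using assms by simp
  finally show "a * q ^ k \<noteq> 1" by (metis norm_one less_irrefl)
qed

lemma qpoch_inf_eq_0: "norm q < 1 \<Longrightarrow> a * q ^ k = 1 \<Longrightarrow> qpoch_inf a q = 0"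
  using qpoch_inf_split[of q a "Suc k"] by (simp add: qpoch_Suc)

lemma qpoch_inf_tail: "norm q < 1 \<Longrightarrow> qpoch_inf (q ^ Suc m) q = qpoch_inf q q * qinv q m"
  using qpoch_inf_split[of q q m] qpoch_mult_qinv[of q m] by (simp add: field_simps)

lemma qpoch_square: "qpoch (q\<^sup>2) (q\<^sup>2) n = qpoch q q n * qpoch (- q) q n"
proof (induction n)
  case (Suc n)
  have "1 - q\<^sup>2 * (q\<^sup>2) ^ n = (1 - q * q ^ n) * (1 - (- q) * q ^ n)"
    by (simp add: algebra_simps power2_eq_square power_mult_distrib)
  then show ?case by (simp add: qpoch_Suc Suc)
qed simp

lemma norm_power2_less_1: "norm (q::complex) < 1 \<Longrightarrow> norm (q\<^sup>2) < 1"
  using norm_power_Suc_less_1[of q 1] by (simp add: numeral_2_eq_2)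

lemma qpoch_inf_square:
  assumes "norm q < 1"
  shows "qpoch_inf (q\<^sup>2) (q\<^sup>2) = qpoch_inf q q * qpoch_inf (- q) q"
proof (rule LIMSEQ_unique)
  show "(\<lambda>n. qpoch (q\<^sup>2) (q\<^sup>2) n) \<longlonglongrightarrow> qpoch_inf (q\<^sup>2) (q\<^sup>2)"
    by (intro qpoch_LIMSEQ norm_power2_less_1 assms)
  show "(\<lambda>n. qpoch (q\<^sup>2) (q\<^sup>2) n) \<longlonglongrightarrow> qpoch_inf q q * qpoch_inf (- q) q"
    unfolding qpoch_square by (intro tendsto_intros qpoch_LIMSEQ assms)
qed

lemma qinv_square: "norm q < 1 \<Longrightarrow> qinv (q\<^sup>2) n * qpoch (- q) q n = qinv q n"
  using qpoch_nonzero[OF norm_power2_less_1, of q n] by (simp add: qinv_def qpoch_square field_simps)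

text \<open>The values \<open>1/(q;q)_n\<close> converge, since their reciprocals tend to a nonzero
  infinite product. The resulting uniform bound on coefficients feeds most of the later summability
  proofs.\<close>

lemma qinv_bounded:
  assumes "norm q < 1"
  obtains C where "C > 0" "\<And>n. norm (qinv q n) \<le> C"
proof -
  have "(\<lambda>n. qinv q n) \<longlonglongrightarrow> inverse (qpoch_inf q q)"
    unfolding qinv_def
    by (intro tendsto_intros qpoch_LIMSEQ qpoch_inf_nonzero' assms)
  then have "Bseq (\<lambda>n. qinv q n)" by (rule convergent_imp_Bseq[OF convergentI])
  then show ?thesis using that by (auto simp: Bseq_def)
qed

subsection \<open>Euler's expansions\<close>

text \<open>Supplies the limit when a functional equation relating \<open>F x\<close> and
  \<open>F (x * q)\<close> is iterated: the argument is driven to 0, where the power series equals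
  1.\<close>

lemma powser_0_iterate:
  fixes F :: "complex \<Rightarrow> complex"
  assumes "norm q < 1" "isCont F 0" "F 0 = 1"
  shows "(\<lambda>n. F (x * q ^ n)) \<longlonglongrightarrow> 1"
proof -
  have "(\<lambda>n. x * q ^ n) \<longlonglongrightarrow> x * 0"
    using assms(1) by (intro tendsto_intros LIMSEQ_power_zero)
  then show ?thesis
    using isCont_tendsto_compose[OF assms(2)] assms(3) by force
qed

text \<open>The recurrence forces \<open>c n\<close> to be
  \<open>(-1)^n q^(n(n-1)/2) / (q;q)_n\<close> and leaves open how the triangular exponent is
  written. The sum satisfies \<open>F x = (1 - x) * F (x * q)\<close>, and iterating this builds up
  the infinite product.\<close>

lemma has_sum_qexp2:
  fixes c :: "nat \<Rightarrow> complex"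
  assumes q: "norm q < 1" and c0: "c 0 = 1"
    and c: "\<And>n. c (Suc n) * (1 - q ^ Suc n) = - (q ^ n) * c n"
  shows "((\<lambda>n. c n * x ^ n) has_sum qpoch_inf x q) UNIV"
proof -
  have summ: "summable (\<lambda>n. norm (c n * x ^ n))" for x
  proof -
    \<comment> \<open>Up to sign this is the ratio of consecutive terms. It tends to 0, so the
      series converges for every \<open>x\<close>; any bound below 1 would do in place of
      \<open>1/2\<close>.\<close>
    have "(\<lambda>n. norm (q ^ n * x / (1 - q ^ Suc n))) \<longlonglongrightarrow> norm (0 * x / (1 - 0))"
      using q by (intro tendsto_intros LIMSEQ_power_zero LIMSEQ_Suc) auto
    then have "eventually (\<lambda>n. norm (q ^ n * x / (1 - q ^ Suc n)) < 1/2) sequentially"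
      by (rule order_tendstoD) simp
    then obtain N where N: "\<And>n. n \<ge> N \<Longrightarrow> norm (q ^ n * x / (1 - q ^ Suc n)) < 1/2"
      by (auto simp: eventually_at_top_linorder)
    show ?thesis
    proof (rule summable_ratio_test[of "1/2" N])
      fix n assume n: "n \<ge> N"
      have "1 - q ^ Suc n \<noteq> 0" using power_Suc_neq_1[OF q, of n] by simp
      then have "c (Suc n) = - (q ^ n) * c n / (1 - q ^ Suc n)" using c[of n] by (simp add: field_simps)
      then have "c (Suc n) * x ^ Suc n = - (q ^ n * x / (1 - q ^ Suc n)) * (c n * x ^ n)"
        by (simp add: field_simps)
      then have "norm (c (Suc n) * x ^ Suc n)
          = norm (q ^ n * x / (1 - q ^ Suc n)) * norm (c n * x ^ n)"
        by (simp only: norm_mult norm_minus_cancel)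
      also have "\<dots> \<le> 1/2 * norm (c n * x ^ n)"
        using N[OF n] by (intro mult_right_mono) auto
      finally show "norm (norm (c (Suc n) * x ^ Suc n)) \<le> 1/2 * norm (norm (c n * x ^ n))" by simp
    qed simp
  qed
  define F where "F = (\<lambda>x. \<Sum>n. c n * x ^ n)"
  have sums: "(\<lambda>n. c n * x ^ n) sums F x" for x
    unfolding F_def by (intro summable_sums summable_norm_cancel[OF summ])
  have F0: "F 0 = 1" unfolding F_def using c0 by (simp add: powser_zero)
  have cont: "isCont F 0"
    unfolding F_def by (intro isCont_powser_converges_everywhere summable_norm_cancel[OF summ])
  have step: "F x = (1 - x) * F (x * q)" for x
  proof -
    have "(\<lambda>n. c n * x ^ n - c n * (x * q) ^ n) sums (F x - F (x * q))"
      by (intro sums_diff sums)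
    then have "(\<lambda>n. c (Suc n) * x ^ Suc n - c (Suc n) * (x * q) ^ Suc n) sums (F x - F (x * q))"
      by (subst sums_Suc_iff) simp
    moreover have "c (Suc n) * x ^ Suc n - c (Suc n) * (x * q) ^ Suc n = - x * (c n * (x * q) ^ n)" for n
    proof -
      have "c (Suc n) * x ^ Suc n - c (Suc n) * (x * q) ^ Suc n = c (Suc n) * (1 - q ^ Suc n) * x ^ Suc n"
        by (simp add: algebra_simps power_mult_distrib)
      then show ?thesis by (simp only: c) (simp add: algebra_simps power_mult_distrib)
    qed
    ultimately have "(\<lambda>n. - x * (c n * (x * q) ^ n)) sums (F x - F (x * q))" by simp
    moreover have "(\<lambda>n. - x * (c n * (x * q) ^ n)) sums (- x * F (x * q))"
      by (intro sums_mult sums)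
    ultimately have "F x - F (x * q) = - x * F (x * q)" by (rule sums_unique2)
    then show ?thesis by (simp add: algebra_simps)
  qed
  have iter: "F x = qpoch x q n * F (x * q ^ n)" for n
  proof (induction n)
    case (Suc n)
    show ?case by (simp add: Suc.IH qpoch_Suc step[of "x * q ^ n"] mult_ac)
  qed simp
  have "(\<lambda>n. qpoch x q n * F (x * q ^ n)) \<longlonglongrightarrow> qpoch_inf x q * 1"
    by (intro tendsto_intros qpoch_LIMSEQ powser_0_iterate q cont F0)
  then have "F x = qpoch_inf x q" unfolding iter[symmetric] by (simp add: LIMSEQ_const_iff)
  with norm_summable_imp_has_sum[OF summ[of x] sums[of x]] show ?thesis by (simp only:)
qed

text \<open>Here the functional equation is \<open>(1 - x) * F x = F (x * q)\<close>, so the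
  infinite product ends up in the denominator.\<close>

lemma has_sum_qexp1:
  assumes q: "norm q < 1" and x: "norm x < 1"
  shows "((\<lambda>n. qinv q n * x ^ n) has_sum inverse (qpoch_inf x q)) UNIV"
proof -
  obtain C where C: "C > 0" "\<And>n. norm (qinv q n) \<le> C" using qinv_bounded[OF q] by blast
  have summ: "summable (\<lambda>n. norm (qinv q n * x ^ n))" if "norm x < 1" for x
  proof (rule summable_comparison_test')
    show "summable (\<lambda>n. C * norm x ^ n)" using that by (intro summable_mult summable_geometric) auto
    show "norm (norm (qinv q n * x ^ n)) \<le> C * norm x ^ n" for n
      using C by (simp add: norm_mult norm_power mult_right_mono)
  qed
  define F where "F = (\<lambda>x. \<Sum>n. qinv q n * x ^ n)"
  have sums: "(\<lambda>n. qinv q n * x ^ n) sums F x" if "norm x < 1" for x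
    unfolding F_def using that by (intro summable_sums summable_norm_cancel[OF summ])
  have F0: "F 0 = 1" unfolding F_def by (simp add: powser_zero)
  have cont: "isCont F 0"
    unfolding F_def by (rule isCont_powser[of _ "1/2"]) (auto intro!: summable_norm_cancel[OF summ])
  have step: "(1 - x) * F x = F (x * q)" if x: "norm x < 1" for x
  proof -
    have xq: "norm (x * q) < 1"
      using mult_strict_mono'[of "norm x" 1 "norm q" 1] x q by (simp add: norm_mult)
    have "(\<lambda>n. qinv q n * x ^ n - qinv q n * (x * q) ^ n) sums (F x - F (x * q))"
      by (intro sums_diff sums x xq)
    then have "(\<lambda>n. qinv q (Suc n) * x ^ Suc n - qinv q (Suc n) * (x * q) ^ Suc n) sums (F x - F (x * q))"
      by (subst sums_Suc_iff) simp
    moreover have "qinv q (Suc n) * x ^ Suc n - qinv q (Suc n) * (x * q) ^ Suc n = x * (qinv q n * x ^ n)" for n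
      unfolding qinv_Suc[OF q, of n, symmetric] by (simp add: algebra_simps power_mult_distrib)
    ultimately have "(\<lambda>n. x * (qinv q n * x ^ n)) sums (F x - F (x * q))" by simp
    moreover have "(\<lambda>n. x * (qinv q n * x ^ n)) sums (x * F x)" by (intro sums_mult sums x)
    ultimately have "F x - F (x * q) = x * F x" by (rule sums_unique2)
    then show ?thesis by (simp add: algebra_simps)
  qed
  have iter: "qpoch x q n * F x = F (x * q ^ n)" for n
  proof (induction n)
    case (Suc n)
    have "norm (x * q ^ n) < 1"
    proof -
      have "norm (x * q ^ n) \<le> norm x * 1"
        unfolding norm_mult norm_power using q by (intro mult_left_mono power_le_one) auto
      then show ?thesis using x by simp
    qed
    from step[OF this] show ?case by (simp add: qpoch_Suc Suc.IH[symmetric] mult_ac)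
  qed simp
  have lim1: "(\<lambda>n. qpoch x q n * F x) \<longlonglongrightarrow> 1"
    unfolding iter by (intro powser_0_iterate q cont F0)
  have "(\<lambda>n. qpoch x q n * F x) \<longlonglongrightarrow> qpoch_inf x q * F x"
    by (intro tendsto_intros qpoch_LIMSEQ q)
  then have "qpoch_inf x q * F x = 1" using lim1 by (rule LIMSEQ_unique)
  then have "F x = inverse (qpoch_inf x q)" by (rule inverse_unique[symmetric])
  with norm_summable_imp_has_sum[OF summ[OF x] sums[OF x]] show ?thesis by (simp only:)
qed

subsection \<open>Finite convolution identities\<close>

text \<open>The substitution of \<open>c X\<close> for \<open>X\<close>; \<open>spread\<close> below
  is the substitution of \<open>X^2\<close> for \<open>X\<close>. On coefficients, q-difference
  equations become recurrences.\<close>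

definition dil :: "complex \<Rightarrow> complex fps \<Rightarrow> complex fps" where
  "dil c f = Abs_fps (\<lambda>n. c ^ n * fps_nth f n)"

definition spread :: "complex fps \<Rightarrow> complex fps" where
  "spread f = Abs_fps (\<lambda>n. if even n then fps_nth f (n div 2) else 0)"

text \<open>By Euler's expansion this is \<open>1/(X;q)_inf\<close> as a formal power
  series.\<close>

definition qE :: "complex \<Rightarrow> complex fps" where
  "qE q = Abs_fps (qinv q)"

text \<open>By Euler's expansion this is \<open>(-X;v^2)_inf\<close>. Taking the base to be a square
  turns the triangular exponent \<open>n(n-1)/2\<close> into \<open>n(n-1)\<close>.\<close>

definition qG :: "complex \<Rightarrow> complex fps" where
  "qG v = Abs_fps (\<lambda>n. v ^ (n * (n - 1)) * qinv (v\<^sup>2) n)"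

lemma dil_nth [simp]: "fps_nth (dil c f) n = c ^ n * fps_nth f n"
  by (simp add: dil_def)

lemma spread_nth: "fps_nth (spread f) n = (if even n then fps_nth f (n div 2) else 0)"
  by (simp add: spread_def)

lemma qE_nth [simp]: "fps_nth (qE q) n = qinv q n"
  by (simp add: qE_def)

lemma qG_nth [simp]: "fps_nth (qG v) n = v ^ (n * (n - 1)) * qinv (v\<^sup>2) n"
  by (simp add: qG_def)

lemma dil_mult: "dil c (f * g) = dil c f * dil c g"
proof (rule fps_ext)
  fix n
  have "c ^ n * (fps_nth f i * fps_nth g (n - i))
      = (c ^ i * fps_nth f i) * (c ^ (n - i) * fps_nth g (n - i))" if "i \<le> n" for i
    using that by (simp add: mult_ac flip: power_add)
  then show "fps_nth (dil c (f * g)) n = fps_nth (dil c f * dil c g) n"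
    unfolding fps_mult_nth dil_nth sum_distrib_left by (intro sum.cong refl) simp
qed

lemma dil_dil: "dil c (dil d f) = dil (c * d) f"
  by (rule fps_ext) (simp add: power_mult_distrib)

lemma dil_1 [simp]: "dil 1 f = f"
  by (rule fps_ext) simp

lemma dil_one [simp]: "dil c 1 = 1"
  by (rule fps_ext) simp

lemma dil_linear: "dil c (1 - fps_const d * fps_X) = 1 - fps_const (c * d) * fps_X"
  by (rule fps_ext) (auto simp: fps_X_def)

text \<open>Comparing coefficients expresses \<open>(q^n - 1)\<close> times the n-th coefficient
  through earlier ones, and \<open>q^n\<close> is not 1 for positive \<open>n\<close>. Identities
  between infinite products thus reduce to checking one q-difference equation.\<close>

lemma dil_unique:
  assumes q: "norm q < 1" and init: "fps_nth f 0 = fps_nth g 0" and R: "fps_nth R 0 = 1"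
    and f: "dil q f = R * f" and g: "dil q g = R * g"
  shows "f = g"
proof (rule fps_ext)
  fix n show "fps_nth f n = fps_nth g n"
  proof (induction n rule: less_induct)
    case (less n)
    show ?case
    proof (cases n)
      case (Suc m)
      have expand: "(q ^ n - 1) * fps_nth h n = (\<Sum>i=1..n. fps_nth R i * fps_nth h (n - i))"
        if "dil q h = R * h" for h
      proof -
        have "q ^ n * fps_nth h n = fps_nth (R * h) n" using that by (metis dil_nth)
        also have "\<dots> = fps_nth h n + (\<Sum>i=1..n. fps_nth R i * fps_nth h (n - i))"
          unfolding fps_mult_nth by (subst sum.atLeast_Suc_atMost) (simp_all add: R)
        finally show ?thesis by (simp add: algebra_simps)
      qed
      have "(\<Sum>i=1..n. fps_nth R i * fps_nth f (n - i)) = (\<Sum>i=1..n. fps_nth R i * fps_nth g (n - i))"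
        by (intro sum.cong refl arg_cong2[where f = "(*)"] less.IH) auto
      with expand[OF f] expand[OF g] have "(q ^ n - 1) * fps_nth f n = (q ^ n - 1) * fps_nth g n"
        by simp
      then show ?thesis using power_Suc_neq_1[OF q, of m] Suc by simp
    qed (use init in simp)
  qed
qed

lemma dil_qE:
  assumes "norm q < 1"
  shows "dil q (qE q) = (1 - fps_X) * qE q"
proof (rule fps_ext)
  fix n show "fps_nth (dil q (qE q)) n = fps_nth ((1 - fps_X) * qE q) n"
    using qinv_Suc[OF assms, of "n - 1"] by (cases n) (auto simp: algebra_simps)
qed

lemma dil_scaled_qE:
  assumes "norm q < 1"
  shows "dil q (dil c (qE q)) = (1 - fps_const c * fps_X) * dil c (qE q)"
proof -
  have "dil q (dil c (qE q)) = dil c (dil q (qE q))" by (simp add: dil_dil mult.commute)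
  also have "dil q (qE q) = (1 - fps_const 1 * fps_X) * qE q" using dil_qE[OF assms] by simp
  finally show ?thesis by (simp only: dil_mult dil_linear) simp
qed

text \<open>The factors of \<open>(X;q)_inf\<close> with even and odd index form
  \<open>(X;q^2)_inf\<close> and \<open>(qX;q^2)_inf\<close>.\<close>

lemma qE_split:
  assumes "norm q < 1"
  shows "qE q = qE (q\<^sup>2) * dil q (qE (q\<^sup>2))"
proof (rule dil_unique[OF assms, of _ _ "1 - fps_X"])
  have "dil q (qE (q\<^sup>2) * dil q (qE (q\<^sup>2))) = dil q (qE (q\<^sup>2)) * dil (q\<^sup>2) (qE (q\<^sup>2))"
    by (simp add: dil_mult dil_dil power2_eq_square)
  also have "dil (q\<^sup>2) (qE (q\<^sup>2)) = (1 - fps_X) * qE (q\<^sup>2)"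
    by (intro dil_qE norm_power2_less_1 assms)
  finally show "dil q (qE (q\<^sup>2) * dil q (qE (q\<^sup>2))) = (1 - fps_X) * (qE (q\<^sup>2) * dil q (qE (q\<^sup>2)))"
    by (simp add: mult_ac)
qed (simp_all add: dil_qE assms)

text \<open>The factors pair up as \<open>(1 - X q^k)(1 + X q^k) = 1 - X^2 q^(2k)\<close>.\<close>

lemma qE_signed:
  assumes "norm q < 1"
  shows "qE q * dil (- 1) (qE q) = spread (qE (q\<^sup>2))"
proof (rule dil_unique[OF assms, of _ _ "(1 - fps_X) * (1 - fps_const (- 1) * fps_X)"])
  show "dil q (qE q * dil (- 1) (qE q))
      = (1 - fps_X) * (1 - fps_const (- 1) * fps_X) * (qE q * dil (- 1) (qE q))"
    by (simp only: dil_mult dil_qE[OF assms] dil_scaled_qE[OF assms] mult_ac)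
  have *: "(1 - fps_X) * (1 - fps_const (- 1) * fps_X) = (1 - fps_X ^ 2 :: complex fps)"
    by (simp add: algebra_simps power2_eq_square flip: fps_const_neg)
  show "dil q (spread (qE (q\<^sup>2)))
      = (1 - fps_X) * (1 - fps_const (- 1) * fps_X) * spread (qE (q\<^sup>2))"
    unfolding *
  proof (rule fps_ext)
    fix n
    have sq: "norm (q\<^sup>2) < 1" by (intro norm_power2_less_1 assms)
    consider "odd n" | "n = 0" | m where "n = 2 * Suc m"
      by (metis evenE not0_implies_Suc mult_0_right)
    then show "fps_nth (dil q (spread (qE (q\<^sup>2)))) n
        = fps_nth ((1 - fps_X ^ 2) * spread (qE (q\<^sup>2))) n"
    proof cases
      case 3
      have "q ^ n = (q\<^sup>2) ^ Suc m" unfolding 3 power_mult ..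
      then show ?thesis using qinv_Suc[OF sq, of m] 3
        by (simp add: left_diff_distrib fps_X_power_mult_nth spread_nth algebra_simps)
    qed (auto simp: left_diff_distrib fps_X_power_mult_nth spread_nth)
  qed
qed (simp_all add: spread_nth)

text \<open>The two series are \<open>(-X;v^2)_inf\<close> and its reciprocal. Their product is
  invariant under \<open>dil (v^2)\<close>, hence constant.\<close>

lemma qG_mult_qE:
  assumes "norm v < 1"
  shows "qG v * dil (- 1) (qE (v\<^sup>2)) = 1"
proof (rule dil_unique[OF norm_power2_less_1[OF assms], of _ _ 1])
  have sq: "norm (v\<^sup>2) < 1" by (intro norm_power2_less_1 assms)
  have G: "(1 - fps_const (- 1) * fps_X) * dil (v\<^sup>2) (qG v) = qG v"
  proof (rule fps_ext)
    fix n
    show "fps_nth ((1 - fps_const (- 1) * fps_X) * dil (v\<^sup>2) (qG v)) n = fps_nth (qG v) n"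
    proof (cases n)
      case (Suc m)
      have "(v\<^sup>2) ^ m * v ^ (m * (m - 1)) = v ^ (Suc m * m)"
        unfolding power_mult[symmetric] power_add[symmetric]
        by (rule arg_cong[where f = "(^) v"]) (cases m; simp add: algebra_simps)
      then have *: "(v\<^sup>2) ^ m * (v ^ (m * (m - 1)) * qinv (v\<^sup>2) m) = v ^ (Suc m * m) * qinv (v\<^sup>2) m"
        by (simp add: mult.assoc[symmetric])
      define Q Q' where "Q = qinv (v\<^sup>2) m" and "Q' = qinv (v\<^sup>2) (Suc m)"
      have Q: "Q' = (v\<^sup>2) ^ Suc m * Q' + Q"
        using qinv_Suc[OF sq, of m] unfolding Q_def Q'_def by (simp add: algebra_simps)
      have "fps_nth ((1 - fps_const (- 1) * fps_X) * dil (v\<^sup>2) (qG v)) n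
          = (v\<^sup>2) ^ Suc m * (v ^ (Suc m * m) * Q') + (v\<^sup>2) ^ m * (v ^ (m * (m - 1)) * Q)"
        unfolding Suc by (simp add: distrib_right mult.assoc Q_def Q'_def flip: fps_const_neg)
      also have "\<dots> = v ^ (Suc m * m) * ((v\<^sup>2) ^ Suc m * Q' + Q)"
        using * by (simp only: Q_def distrib_left mult.left_commute)
      also have "\<dots> = v ^ (Suc m * m) * Q'" unfolding Q[symmetric] ..
      finally show ?thesis by (simp add: Suc Q'_def)
    qed (simp add: left_diff_distrib mult.assoc)
  qed
  show "dil (v\<^sup>2) (qG v * dil (- 1) (qE (v\<^sup>2))) = 1 * (qG v * dil (- 1) (qE (v\<^sup>2)))"
    unfolding dil_mult dil_scaled_qE[OF sq] using G by (simp add: mult_ac)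
qed simp_all

text \<open>The series \<open>spread (qE (v^2))\<close> is the reciprocal of
  \<open>(X;v)_inf (-X;v^2)_inf (-vX;v^2)_inf\<close>. The factor \<open>dil (v^e) (qG v)\<close>
  cancels the second product when \<open>e = 0\<close> and the third when
  \<open>e = 1\<close>.\<close>

lemma qG_mult_spread:
  assumes v: "norm v < 1" and e: "e = (0::nat) \<or> e = 1"
  shows "dil (v ^ e) (qG v) * spread (qE (v\<^sup>2)) = qE v * dil (- (v ^ (1 - e))) (qE (v\<^sup>2))"
proof -
  have "dil (- 1) (qE v) = dil (- 1) (qE (v\<^sup>2)) * dil (- v) (qE (v\<^sup>2))"
    by (subst qE_split[OF v]) (simp add: dil_mult dil_dil)
  then have s: "spread (qE (v\<^sup>2)) = qE v * (dil (- 1) (qE (v\<^sup>2)) * dil (- v) (qE (v\<^sup>2)))"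
    using qE_signed[OF v] by simp
  have "dil v (qG v) * dil (- v) (qE (v\<^sup>2)) = dil v (qG v * dil (- 1) (qE (v\<^sup>2)))"
    by (simp add: dil_mult dil_dil)
  then have 1: "dil v (qG v) * dil (- v) (qE (v\<^sup>2)) = 1"
    by (simp add: qG_mult_qE[OF v])
  from e show ?thesis
  proof
    assume "e = 0"
    then have "dil (v ^ e) (qG v) * spread (qE (v\<^sup>2))
        = qE v * dil (- v) (qE (v\<^sup>2)) * (qG v * dil (- 1) (qE (v\<^sup>2)))" by (simp add: s mult_ac)
    then show ?thesis using \<open>e = 0\<close> by (simp add: qG_mult_qE[OF v])
  next
    assume "e = 1"
    then have "dil (v ^ e) (qG v) * spread (qE (v\<^sup>2))
        = qE v * dil (- 1) (qE (v\<^sup>2)) * (dil v (qG v) * dil (- v) (qE (v\<^sup>2)))" by (simp add: s mult_ac)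
    then show ?thesis using \<open>e = 1\<close> by (simp add: 1)
  qed
qed

subsection \<open>Summability and rearrangement\<close>

text \<open>Summing along antidiagonals transfers product identities of formal series to double sums
  against an arbitrary weight \<open>t (i + j)\<close>.\<close>

lemma infsum_fps_mult:
  fixes f g :: "complex fps"
  assumes "(\<lambda>(i, j). fps_nth f i * fps_nth g j * t (i + j)) summable_on UNIV"
  shows "(\<Sum>\<^sub>\<infinity>(i, j). fps_nth f i * fps_nth g j * t (i + j)) = (\<Sum>\<^sub>\<infinity>n. fps_nth (f * g) n * t n)"
proof -
  let ?F = "\<lambda>(i, j). fps_nth f i * fps_nth g j * t (i + j)"
  have bij: "bij_betw (\<lambda>(n, i). (i, n - i)) (SIGMA n:UNIV. {..n}) (UNIV :: (nat \<times> nat) set)"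
    by (rule bij_betwI[of _ _ _ "\<lambda>(i, j). (i + j, i)"]) auto
  have "(\<Sum>\<^sub>\<infinity>x. ?F x) = (\<Sum>\<^sub>\<infinity>x\<in>(SIGMA n:UNIV. {..n}). ?F ((\<lambda>(n, i). (i, n - i)) x))"
    by (rule infsum_reindex_bij_betw[OF bij, symmetric])
  also have "\<dots> = (\<Sum>\<^sub>\<infinity>n. \<Sum>\<^sub>\<infinity>i\<in>{..n}. ?F (i, n - i))"
    by (subst infsum_Sigma_banach[symmetric])
       (use assms in \<open>simp_all add: summable_on_reindex_bij_betw[OF bij]\<close>)
  also have "\<dots> = (\<Sum>\<^sub>\<infinity>n. fps_nth (f * g) n * t n)"
    by (simp add: fps_mult_nth sum_distrib_right atMost_atLeast0)
  finally show ?thesis .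
qed

lemma infsum_spread:
  fixes f :: "complex fps"
  shows "(\<Sum>\<^sub>\<infinity>n. fps_nth (spread f) n * t n) = (\<Sum>\<^sub>\<infinity>k. fps_nth f k * t (2 * k))"
proof -
  have "(\<Sum>\<^sub>\<infinity>n. fps_nth (spread f) n * t n) = (\<Sum>\<^sub>\<infinity>n\<in>range ((*) 2). fps_nth (spread f) n * t n)"
    by (rule infsum_cong_neutral) (auto simp: spread_nth elim!: evenE)
  also have "\<dots> = (\<Sum>\<^sub>\<infinity>k. fps_nth (spread f) (2 * k) * t (2 * k))"
    by (subst infsum_reindex) (auto simp: inj_on_def o_def)
  finally show ?thesis by (simp add: spread_nth)
qed

lemma summable_on_power_abs_int:
  fixes d :: real
  assumes "0 \<le> d" "d < 1"
  shows "(\<lambda>n::int. d ^ nat \<bar>n\<bar>) summable_on UNIV"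
proof -
  have nat: "(\<lambda>n::nat. d ^ n) summable_on UNIV"
    using assms by (intro summable_nonneg_imp_summable_on summable_geometric) auto
  have "(\<lambda>n. d ^ nat \<bar>n\<bar>) summable_on range int"
    by (subst summable_on_reindex) (use nat in \<open>auto simp: o_def\<close>)
  moreover have "(\<lambda>n. d ^ nat \<bar>n\<bar>) summable_on range (\<lambda>n. - int n)"
    by (subst summable_on_reindex) (use nat in \<open>auto simp: o_def inj_on_def\<close>)
  ultimately have "(\<lambda>n. d ^ nat \<bar>n\<bar>) summable_on (range int \<union> range (\<lambda>n. - int n))"
    by (rule summable_on_union)
  moreover have "range int \<union> range (\<lambda>n. - int n) = UNIV"
  proof -
    have "x \<in> range int \<union> range (\<lambda>n. - int n)" for x by (cases x rule: int_cases2) auto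
    then show ?thesis by blast
  qed
  ultimately show ?thesis by simp
qed

lemma summable_on_prod_real:
  fixes f :: "'a \<Rightarrow> real" and g :: "'b \<Rightarrow> real"
  assumes "f summable_on A" "g summable_on B" "\<And>x. f x \<ge> 0" "\<And>y. g y \<ge> 0"
  shows "(\<lambda>(x, y). f x * g y) summable_on (A \<times> B)"
proof (rule summable_on_SigmaI)
  show "((\<lambda>y. case (x, y) of (x, y) \<Rightarrow> f x * g y) has_sum f x * infsum g B) B" for x
    using has_sum_cmult_right[OF has_sum_infsum[OF assms(2)], of "f x"] by simp
  show "(\<lambda>x. f x * infsum g B) summable_on A"
    by (intro summable_on_cmult_left assms)
qed (use assms in auto)

text \<open>Comparison with a product of three two-sided geometric series. Sums over fewer indices
  use the constant 0 as a coordinate.\<close>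

lemma summable_on_geometric_bound:
  fixes f :: "'a \<Rightarrow> complex" and u v w :: "'a \<Rightarrow> int" and d C :: real
  assumes d: "0 \<le> d" "d < 1" and inj: "inj_on (\<lambda>x. (u x, v x, w x)) A"
    and bound: "\<And>x. x \<in> A \<Longrightarrow> norm (f x) \<le> C * d ^ nat (\<bar>u x\<bar> + \<bar>v x\<bar> + \<bar>w x\<bar>)"
  shows "f summable_on A"
proof -
  define G :: "int \<times> int \<times> int \<Rightarrow> real" where
    "G = (\<lambda>(x, y, z). C * d ^ nat (\<bar>x\<bar> + \<bar>y\<bar> + \<bar>z\<bar>))"
  have "(\<lambda>(x, y, z). d ^ nat \<bar>x\<bar> * (d ^ nat \<bar>y\<bar> * d ^ nat \<bar>z\<bar>))
          summable_on ((UNIV :: int set) \<times> (UNIV \<times> UNIV :: (int \<times> int) set))"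
    using summable_on_prod_real[OF summable_on_power_abs_int[OF d] summable_on_prod_real[OF
        summable_on_power_abs_int[OF d] summable_on_power_abs_int[OF d]]] d
    by (simp add: case_prod_unfold)
  then have "(\<lambda>x. C * (case x of (x, y, z) \<Rightarrow> d ^ nat \<bar>x\<bar> * (d ^ nat \<bar>y\<bar> * d ^ nat \<bar>z\<bar>))) summable_on UNIV"
    by (intro summable_on_cmult_right) simp
  then have "G summable_on UNIV"
    by (rule summable_on_cong[THEN iffD1, rotated]) (auto simp: G_def nat_add_distrib power_add)
  then have "G summable_on ((\<lambda>x. (u x, v x, w x)) ` A)"
    by (rule summable_on_subset_banach) simp
  then have "(G \<circ> (\<lambda>x. (u x, v x, w x))) summable_on A"
    by (subst (asm) summable_on_reindex[OF inj])
  then have "(\<lambda>x. norm (f x)) summable_on A"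
    by (rule Infinite_Sum.abs_summable_on_comparison_test') (use bound in \<open>auto simp: G_def\<close>)
  then show ?thesis by (rule abs_summable_summable)
qed

text \<open>Passing to \<open>sqrt (norm r)\<close> doubles the exponent, so a linear weight only
  has to stay below \<open>2 * E + c\<close>. The constant \<open>c\<close> absorbs the small
  indices at which a quadratic exponent lies below its linear bound.\<close>

lemma norm_powi_bound:
  fixes r :: complex
  assumes r: "r \<noteq> 0" "norm r < 1" and w: "0 \<le> w" "w \<le> 2 * E + c"
  shows "norm (r powi E) \<le> sqrt (norm r) powi (- c) * sqrt (norm r) ^ nat w"
proof -
  define d where "d = sqrt (norm r)"
  have d: "0 < d" "d < 1" using r by (auto simp: d_def)
  have "norm (r powi E) = (d ^ 2) powi E" by (simp add: norm_power_int d_def)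
  also have "\<dots> = d powi (2 * E)" by (simp add: power_int_power)
  also have "\<dots> \<le> d powi (- c + w)"
    using d w by (intro power_int_decreasing) auto
  also have "\<dots> = d powi (- c) * d ^ nat w"
    by (subst power_int_add) (use d w in \<open>auto simp: power_int_nonneg_exp\<close>)
  finally show ?thesis by (simp add: d_def)
qed

lemma summable_on_powi_bound:
  fixes r :: complex and f :: "'a \<Rightarrow> complex" and E u v w :: "'a \<Rightarrow> int"
  assumes r: "r \<noteq> 0" "norm r < 1" and inj: "inj_on (\<lambda>x. (u x, v x, w x)) A" and C: "C \<ge> 0"
    and f: "\<And>x. x \<in> A \<Longrightarrow> norm (f x) \<le> C * norm (r powi E x)"
    and E: "\<And>x. x \<in> A \<Longrightarrow> \<bar>u x\<bar> + \<bar>v x\<bar> + \<bar>w x\<bar> \<le> 2 * E x + c"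
  shows "f summable_on A"
proof (rule summable_on_geometric_bound[OF _ _ inj, of "sqrt (norm r)" _ "C * sqrt (norm r) powi (- c)"])
  fix x assume x: "x \<in> A"
  have "norm (r powi E x) \<le> sqrt (norm r) powi (- c) * sqrt (norm r) ^ nat (\<bar>u x\<bar> + \<bar>v x\<bar> + \<bar>w x\<bar>)"
    using E[OF x] by (intro norm_powi_bound r) auto
  from mult_left_mono[OF this C] f[OF x]
  show "norm (f x) \<le> C * sqrt (norm r) powi (- c) * sqrt (norm r) ^ nat (\<bar>u x\<bar> + \<bar>v x\<bar> + \<bar>w x\<bar>)"
    by (simp only: mult.assoc)
qed (use r in auto)

lemma int_square_ge: "2 * \<bar>b\<bar> \<le> b * b + (1::int)"
proof -
  have "0 \<le> (\<bar>b\<bar> - 1) * (\<bar>b\<bar> - 1)" by simp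
  then show ?thesis by (simp add: algebra_simps)
qed

section \<open>Euler's second expansion in base \<open>v^2\<close> at integer powers of
  \<open>v\<close>\<close>

lemma has_sum_qexp2_powi:
  assumes v: "v \<noteq> 0" "norm v < 1"
  shows "((\<lambda>n. (- 1) ^ n * v powi (int n * int n - int n) * qinv (v\<^sup>2) n * x ^ n) has_sum qpoch_inf x (v\<^sup>2)) UNIV"
proof (rule has_sum_qexp2[OF norm_power2_less_1[OF v(2)]])
  fix n
  have "v powi (int (Suc n) * int (Suc n) - int (Suc n)) = v powi (int n * int n - int n) * v powi (2 * int n)"
    using v by (subst power_int_add[symmetric]) (auto simp: algebra_simps)
  also have "v powi (2 * int n) = (v\<^sup>2) ^ n" by (simp add: power_int_mult)
  finally show "(- 1) ^ Suc n * v powi (int (Suc n) * int (Suc n) - int (Suc n)) * qinv (v\<^sup>2) (Suc n) * (1 - (v\<^sup>2) ^ Suc n)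
      = - ((v\<^sup>2) ^ n) * ((- 1) ^ n * v powi (int n * int n - int n) * qinv (v\<^sup>2) n)"
    using qinv_Suc[OF norm_power2_less_1[OF v(2)], of n] by (simp add: mult_ac)
qed simp

text \<open>The product \<open>(q q\<^sup>m; q)\<^sub>\<infinity>\<close> with \<open>q = v\<^sup>2\<close>; for negative \<open>m\<close> one factor is zero.\<close>

definition euler_tail :: "complex \<Rightarrow> int \<Rightarrow> complex" where
  "euler_tail v m = (if m < 0 then 0 else qpoch_inf (v\<^sup>2) (v\<^sup>2) * qinv (v\<^sup>2) (nat m))"

text \<open>Euler's expansion at \<open>x = q^(m+1)\<close> with \<open>q = v^2\<close>. It trades a
  factor \<open>1/(q;q)_m\<close> for a sum over \<open>l\<close> that is quadratic jointly in
  \<open>l\<close> and \<open>m\<close>, and the zero at negative \<open>m\<close> lets a sum over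
  naturals run over all integers.\<close>

lemma has_sum_euler_tail:
  assumes v: "v \<noteq> 0" "norm v < 1"
  shows "((\<lambda>l. (- 1) ^ l * v powi (int l * int l + int l + 2 * m * int l) * qinv (v\<^sup>2) l) has_sum euler_tail v m) UNIV"
proof -
  define x where "x = v powi (2 + 2 * m)"
  have "(- 1) ^ l * v powi (int l * int l - int l) * qinv (v\<^sup>2) l * x ^ l
      = (- 1) ^ l * v powi (int l * int l + int l + 2 * m * int l) * qinv (v\<^sup>2) l" for l
  proof -
    have "v powi (int l * int l - int l) * x ^ l = v powi (int l * int l + int l + 2 * m * int l)"
      unfolding x_def power_int_power' using v
      by (subst power_int_add[symmetric]) (auto simp: algebra_simps)
    then show ?thesis by (simp add: mult_ac)
  qed
  with has_sum_qexp2_powi[OF v, of x]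
  have "((\<lambda>l. (- 1) ^ l * v powi (int l * int l + int l + 2 * m * int l) * qinv (v\<^sup>2) l) has_sum qpoch_inf x (v\<^sup>2)) UNIV"
    by simp
  moreover have "qpoch_inf x (v\<^sup>2) = euler_tail v m"
  proof (cases "m < 0")
    case True
    \<comment> \<open>The vanishing factor of the product is the one with index
      \<open>- 1 - m\<close>.\<close>
    have "(v\<^sup>2) ^ nat (- 1 - m) = v powi (2 * (- 1 - m))"
      using True by (simp only: power_int_mult power_int_numeral) (simp add: power_int_nonneg_exp)
    then have "x * (v\<^sup>2) ^ nat (- 1 - m) = v powi (2 + 2 * m + 2 * (- 1 - m))"
      unfolding x_def using v by (simp only: power_int_add simp_thms)
    then have "x * (v\<^sup>2) ^ nat (- 1 - m) = 1" by simp
    then show ?thesis using True qpoch_inf_eq_0[OF norm_power2_less_1[OF v(2)]] by (simp add: euler_tail_def)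
  next
    case False
    then have "x = v powi (2 * int (Suc (nat m)))" by (simp add: x_def)
    also have "\<dots> = (v\<^sup>2) ^ Suc (nat m)" by (simp only: power_int_mult power_int_of_nat power_int_numeral)
    finally show ?thesis using False qpoch_inf_tail[OF norm_power2_less_1[OF v(2)], of "nat m"]
      by (simp add: euler_tail_def)
  qed
  ultimately show ?thesis by simp
qed

text \<open>Completing the square reduces the series to Euler's expansion at
  \<open>x = -q^(-n)\<close> with \<open>q = v^2\<close>. The first \<open>n\<close> factors of
  \<open>(-q^(-n);q)_inf\<close> give \<open>(-q;q)_n\<close>, up to the power of \<open>q\<close>
  that completing the square produced.\<close>

lemma has_sum_shifted_theta:
  assumes v: "v \<noteq> 0" "norm v < 1"
  shows "((\<lambda>l. v powi ((int l - int n) * (int l - int n) - (int l - int n)) * qinv (v\<^sup>2) l)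
    has_sum qpoch (- (v\<^sup>2)) (v\<^sup>2) n * qpoch_inf (- 1) (v\<^sup>2)) UNIV"
proof -
  define x where "x = - (v powi (- 2 * int n))"
  have summand: "v powi (int n * int n + int n) * ((- 1) ^ l * v powi (int l * int l - int l) * qinv (v\<^sup>2) l * x ^ l)
      = v powi ((int l - int n) * (int l - int n) - (int l - int n)) * qinv (v\<^sup>2) l" for l
  proof -
    have *: "v powi (int n * int n + int n) * (v powi (int l * int l - int l) * (v powi (- 2 * int n)) ^ l)
        = v powi ((int l - int n) * (int l - int n) - (int l - int n))"
      unfolding power_int_power' using v
      by (simp only: power_int_add[symmetric] simp_thms) (simp add: algebra_simps)
    have x: "(- 1) ^ l * x ^ l = (v powi (- 2 * int n)) ^ l"
      unfolding x_def power_mult_distrib[symmetric] by simp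
    have "v powi (int n * int n + int n) * ((- 1) ^ l * v powi (int l * int l - int l) * qinv (v\<^sup>2) l * x ^ l)
        = v powi (int n * int n + int n) * (v powi (int l * int l - int l) * ((- 1) ^ l * x ^ l)) * qinv (v\<^sup>2) l"
      by (simp only: mult_ac)
    then show ?thesis unfolding x * .
  qed
  have total: "v powi (int n * int n + int n) * qpoch_inf (- (v powi (- 2 * int n))) (v\<^sup>2)
      = qpoch (- (v\<^sup>2)) (v\<^sup>2) n * qpoch_inf (- 1) (v\<^sup>2)"
  proof (induction n)
    case (Suc n)
    have q: "norm (v\<^sup>2) < 1" by (intro norm_power2_less_1 v)
    define w w' y A P where "w = v powi (- 2 * int (Suc n))" and "w' = v powi (- 2 * int n)"
      and "y = v powi (2 * int (Suc n))" and "A = v powi (int n * int n + int n)"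
      and "P = qpoch_inf (- w') (v\<^sup>2)"
    have 1: "w * v\<^sup>2 = w'"
      unfolding w_def w'_def using v power_int_add[of v "- 2 * int (Suc n)" 2] by (simp add: algebra_simps)
    have 2: "v powi (int (Suc n) * int (Suc n) + int (Suc n)) = A * y"
      unfolding A_def y_def using v by (subst power_int_add[symmetric]) (auto simp: algebra_simps)
    have 3: "y * w = 1"
      unfolding y_def w_def using v by (subst power_int_add[symmetric]) auto
    have 4: "y = v\<^sup>2 * (v\<^sup>2) ^ n"
      unfolding y_def by (simp only: power_int_mult power_int_of_nat power_int_numeral power_Suc)
    have 5: "qpoch_inf (- w) (v\<^sup>2) = (1 + w) * P"
      using qpoch_inf_head[OF q, of "- w"] by (simp add: P_def flip: 1)
    have "A * y * qpoch_inf (- w) (v\<^sup>2) = (y + y * w) * (A * P)"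
      unfolding 5 by (simp add: algebra_simps)
    also have "\<dots> = (1 + v\<^sup>2 * (v\<^sup>2) ^ n) * (A * P)" unfolding 3 unfolding 4 by (simp add: add.commute)
    also have "A * P = qpoch (- (v\<^sup>2)) (v\<^sup>2) n * qpoch_inf (- 1) (v\<^sup>2)"
      unfolding A_def P_def w'_def by (rule Suc.IH)
    finally show ?case unfolding 2 w_def[symmetric] qpoch_Suc by (simp add: mult_ac)
  qed simp
  show ?thesis
    using has_sum_cmult_right[OF has_sum_qexp2_powi[OF v, of x], of "v powi (int n * int n + int n)"]
    unfolding summand unfolding x_def total .
qed

section \<open>Jacobi's theta_2 without its factor \<open>v^(1/4)\<close>, and Gauss's product for
  it\<close>

definition theta2 :: "complex \<Rightarrow> complex" where
  "theta2 v = (\<Sum>\<^sub>\<infinity>b::int. v powi (b * b - b))"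

lemma summable_on_theta2:
  fixes v :: complex
  assumes v: "v \<noteq> 0" "norm v < 1"
  shows "(\<lambda>b::int. v powi (b * b - b)) summable_on UNIV"
proof (rule summable_on_powi_bound[OF v, where u = "\<lambda>b. b" and v = "\<lambda>_. 0" and w = "\<lambda>_. 0" and C = 1])
  fix b :: int
  show "\<bar>b\<bar> + \<bar>0\<bar> + \<bar>0\<bar> \<le> 2 * (b * b - b) + 2" using int_square_ge[of b] abs_ge_self[of b] by (simp add: algebra_simps)
qed (auto simp: inj_on_def)

lemma infsum_int_shift: "(\<Sum>\<^sub>\<infinity>b::int. f (b + c)) = (\<Sum>\<^sub>\<infinity>b. f b)"
  by (rule infsum_reindex_bij_witness[of _ "\<lambda>b. b - c" "\<lambda>b. b + c"]) auto

lemma infsum_int_reflect: "(\<Sum>\<^sub>\<infinity>b::int. f (c - b)) = (\<Sum>\<^sub>\<infinity>b. f b)"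
  by (rule infsum_reindex_bij_witness[of _ "\<lambda>b. c - b" "\<lambda>b. c - b"]) auto

lemma infsum_int_nonneg:
  assumes "\<And>m. m < 0 \<Longrightarrow> f m = 0"
  shows "(\<Sum>\<^sub>\<infinity>m::int. f m) = (\<Sum>\<^sub>\<infinity>n::nat. f (int n))"
proof -
  have "m \<in> range int" if "f m \<noteq> 0" for m using that assms[of m] by (cases m rule: int_cases2) force+
  then have "(\<Sum>\<^sub>\<infinity>m::int. f m) = (\<Sum>\<^sub>\<infinity>m\<in>range int. f m)"
    by (intro infsum_cong_neutral) auto
  also have "\<dots> = (\<Sum>\<^sub>\<infinity>n::nat. f (int n))" by (subst infsum_reindex) (auto simp: o_def)
  finally show ?thesis .
qed

text \<open>Gauss's product; the two-sided sum counts every triangular exponent twice.\<close>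

lemma theta2_product:
  assumes v: "v \<noteq> 0" "norm v < 1"
  shows "theta2 v = qpoch_inf (v\<^sup>2) (v\<^sup>2) * qpoch_inf (- 1) (v\<^sup>2) * qpoch_inf (- (v\<^sup>2)) (v\<^sup>2)"
proof -
  define q where "q = v\<^sup>2"
  have q: "norm q < 1" unfolding q_def by (intro norm_power2_less_1 v)
  obtain C where C: "C > 0" "\<And>n. norm (qinv q n) \<le> C" using qinv_bounded[OF q] by blast
  \<comment> \<open>This double series is summed in both orders. The sum over \<open>m\<close> first
    gives \<open>theta2 v\<close> times the expansion of \<open>1/(-q;q)_inf\<close>. The sum over
    \<open>i\<close> first gives Euler tails, which cut the sum over \<open>m\<close> down to one
    side, where Euler's expansion at \<open>-1\<close> applies.\<close>
  define F :: "nat \<Rightarrow> int \<Rightarrow> complex" where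
    "F = (\<lambda>i m. (- 1) ^ i * v powi ((m - int i) * (m - int i) + (m - int i) + 2 * int i) * qinv q i)"
  have summ: "(\<lambda>(i, m). F i m) summable_on UNIV \<times> UNIV"
  proof (rule summable_on_powi_bound[OF v, where u = "\<lambda>(i, m). int i" and v = "\<lambda>(i, m). m - int i" and w = "\<lambda>_. 0"
        and C = C and E = "\<lambda>(i, m). (m - int i) * (m - int i) + (m - int i) + 2 * int i"])
    fix x :: "nat \<times> int" assume "x \<in> UNIV \<times> UNIV"
    obtain i m where x: "x = (i, m)" by force
    show "norm (case x of (i, m) \<Rightarrow> F i m) \<le> C * norm (v powi (case x of (i, m) \<Rightarrow> (m - int i) * (m - int i) + (m - int i) + 2 * int i))"
      unfolding x prod.case F_def norm_mult using C(2)[of i]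
      by (subst mult.commute) (simp add: norm_power mult_right_mono)
    show "\<bar>case x of (i, m) \<Rightarrow> int i\<bar> + \<bar>case x of (i, m) \<Rightarrow> m - int i\<bar> + \<bar>0\<bar>
      \<le> 2 * (case x of (i, m) \<Rightarrow> (m - int i) * (m - int i) + (m - int i) + 2 * int i) + 2"
    proof -
      define b where "b = m - int i"
      have "int i + \<bar>b\<bar> \<le> 2 * (b * b + b + 2 * int i) + 2"
        using int_square_ge[of b] abs_ge_minus_self[of b] by (simp add: distrib_left)
      then show ?thesis unfolding x prod.case b_def by simp
    qed
  qed (use C in \<open>auto simp: inj_on_def\<close>)
  have "(\<Sum>\<^sub>\<infinity>m. F i m) = theta2 v * (qinv q i * (- q) ^ i)" for i
  proof -
    have "(\<Sum>\<^sub>\<infinity>m. F i m) = (\<Sum>\<^sub>\<infinity>m. F i (int i - m))" by (rule infsum_int_reflect[symmetric])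
    also have "\<dots> = (\<Sum>\<^sub>\<infinity>m. v powi (m * m - m) * (qinv q i * (- q) ^ i))"
    proof (rule infsum_cong)
      fix m
      have "v powi (m * m - m + 2 * int i) = v powi (m * m - m) * q ^ i"
        using v by (subst power_int_add) (auto simp: power_int_mult q_def)
      moreover have "(int i - m - int i) * (int i - m - int i) + (int i - m - int i) + 2 * int i = m * m - m + 2 * int i"
        by simp
      ultimately show "F i (int i - m) = v powi (m * m - m) * (qinv q i * (- q) ^ i)"
        by (simp only: F_def power_minus[of q] mult_ac)
    qed
    also have "\<dots> = theta2 v * (qinv q i * (- q) ^ i)"
      unfolding theta2_def by (rule infsum_cmult_left')
    finally show ?thesis .
  qed
  then have "(\<Sum>\<^sub>\<infinity>i. \<Sum>\<^sub>\<infinity>m. F i m) = theta2 v * (\<Sum>\<^sub>\<infinity>i. qinv q i * (- q) ^ i)"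
    by (simp add: infsum_cmult_right')
  also have "\<dots> = theta2 v * inverse (qpoch_inf (- q) q)"
    using infsumI[OF has_sum_qexp1[OF q, of "- q"]] q by simp
  finally have 1: "(\<Sum>\<^sub>\<infinity>i. \<Sum>\<^sub>\<infinity>m. F i m) = theta2 v * inverse (qpoch_inf (- q) q)" .
  have "(\<Sum>\<^sub>\<infinity>i. F i m) = v powi (m * m + m) * euler_tail v (- m)" for m
  proof -
    have "F i m = v powi (m * m + m) * ((- 1) ^ i * v powi (int i * int i + int i + 2 * (- m) * int i) * qinv q i)" for i
    proof -
      have "v powi ((m - int i) * (m - int i) + (m - int i) + 2 * int i)
          = v powi (m * m + m) * v powi (int i * int i + int i + 2 * (- m) * int i)"
        using v by (subst power_int_add[symmetric]) (auto simp: algebra_simps)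
      then show ?thesis by (simp add: F_def mult_ac)
    qed
    then show ?thesis
      using infsumI[OF has_sum_cmult_right[OF has_sum_euler_tail[OF v, of "- m"], of "v powi (m * m + m)"]]
      by (simp add: q_def)
  qed
  then have "(\<Sum>\<^sub>\<infinity>m. \<Sum>\<^sub>\<infinity>i. F i m) = (\<Sum>\<^sub>\<infinity>m. v powi (m * m + m) * euler_tail v (- m))" by simp
  also have "\<dots> = (\<Sum>\<^sub>\<infinity>m. v powi (m * m - m) * euler_tail v m)"
    using infsum_int_reflect[of "\<lambda>m. v powi (m * m + m) * euler_tail v (- m)" 0] by simp
  also have "\<dots> = (\<Sum>\<^sub>\<infinity>n. v powi (int n * int n - int n) * euler_tail v (int n))"
    by (rule infsum_int_nonneg) (simp add: euler_tail_def)
  also have "\<dots> = (\<Sum>\<^sub>\<infinity>n. qpoch_inf q q * ((- 1) ^ n * v powi (int n * int n - int n) * qinv q n * (- 1) ^ n))"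
    by (intro infsum_cong) (simp add: euler_tail_def q_def mult_ac flip: power_mult_distrib)
  also have "\<dots> = qpoch_inf q q * qpoch_inf (- 1) q"
    using infsumI[OF has_sum_qexp2_powi[OF v, of "- 1"]] by (simp add: infsum_cmult_right' q_def)
  finally have "theta2 v * inverse (qpoch_inf (- q) q) = qpoch_inf q q * qpoch_inf (- 1) q"
    using infsum_swap_banach[OF summ] 1 by simp
  moreover have "qpoch_inf (- q) q \<noteq> 0" by (intro qpoch_inf_nonzero') (use q in auto)
  ultimately show ?thesis by (simp add: field_simps q_def)
qed

lemma theta2_nonzero:
  assumes v: "v \<noteq> 0" "norm v < 1"
  shows "theta2 v \<noteq> 0"
proof -
  have q: "norm (v\<^sup>2) < 1" by (intro norm_power2_less_1 v)
  \<comment> \<open>The argument \<open>-1\<close> lies on the unit circle, outside the range of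
    \<open>qpoch_inf_nonzero'\<close>, so its first factor \<open>2\<close> is split off.\<close>
  have "qpoch_inf (- 1) (v\<^sup>2) = 2 * qpoch_inf (- (v\<^sup>2)) (v\<^sup>2)"
    by (subst qpoch_inf_head[OF q]) simp
  then show ?thesis
    unfolding theta2_product[OF v] using q by (simp add: qpoch_inf_nonzero')
qed

lemma infsum_pair_spread:
  fixes f g :: "complex fps"
  shows "(\<Sum>\<^sub>\<infinity>(i, j). fps_nth f i * fps_nth g j * t (i + 2 * j))
      = (\<Sum>\<^sub>\<infinity>(i, j). fps_nth f i * fps_nth (spread g) j * t (i + j))"
proof -
  have "(\<Sum>\<^sub>\<infinity>(i, j). fps_nth f i * fps_nth (spread g) j * t (i + j))
      = (\<Sum>\<^sub>\<infinity>(i, j)\<in>range (map_prod id ((*) 2)). fps_nth f i * fps_nth (spread g) j * t (i + j))"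
  proof (rule infsum_cong_neutral)
    fix x :: "nat \<times> nat" assume x: "x \<in> UNIV - range (map_prod id ((*) 2))"
    obtain i j where ij: "x = (i, j)" by force
    have "odd j"
    proof
      assume "even j"
      then obtain k where "(i, j) = map_prod id ((*) 2) (i, k)" by (auto elim: evenE)
      then show False using x unfolding ij by (metis Diff_iff rangeI)
    qed
    then show "(case x of (i, j) \<Rightarrow> fps_nth f i * fps_nth (spread g) j * t (i + j)) = 0"
      by (simp add: ij spread_nth)
  qed auto
  also have "\<dots> = (\<Sum>\<^sub>\<infinity>(i, j). fps_nth f i * fps_nth (spread g) (2 * j) * t (i + 2 * j))"
    by (subst infsum_reindex) (auto simp: inj_on_def o_def case_prod_unfold)
  finally show ?thesis by (simp add: spread_nth)
qed

lemma summable_on_decaying: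
  fixes f g :: "nat \<Rightarrow> complex" and t :: "int \<Rightarrow> complex" and d C D K :: real
  assumes d: "0 \<le> d" "d < 1" and f: "\<And>i. norm (f i) \<le> C" and g: "\<And>j. norm (g j) \<le> D"
    and t: "\<And>n. norm (t n) \<le> K * d ^ nat \<bar>n\<bar>" and h: "\<And>i j. int i + int j \<le> \<bar>h i j\<bar>"
  shows "(\<lambda>(i, j). f i * g j * t (h i j)) summable_on UNIV"
proof (rule summable_on_geometric_bound[OF d, where u = "\<lambda>(i, j). int i" and v = "\<lambda>(i, j). int j" and w = "\<lambda>_. 0"])
  fix x :: "nat \<times> nat"
  obtain i j where x: "x = (i, j)" by force
  have pos: "0 \<le> C" "0 \<le> D" "0 \<le> K"
    using order_trans[OF norm_ge_zero f] order_trans[OF norm_ge_zero g]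
      order_trans[OF norm_ge_zero t[of 0]] by auto
  have "norm (f i * g j * t (h i j)) \<le> C * D * (K * d ^ nat \<bar>h i j\<bar>)"
    unfolding norm_mult using pos d by (intro mult_mono f g t) auto
  also have "\<dots> \<le> C * D * (K * d ^ nat (int i + int j))"
    using pos d h[of i j] by (intro mult_left_mono power_decreasing) auto
  finally show "norm (case x of (i, j) \<Rightarrow> f i * g j * t (h i j))
      \<le> C * D * K * d ^ nat (\<bar>case x of (i, j) \<Rightarrow> int i\<bar> + \<bar>case x of (i, j) \<Rightarrow> int j\<bar> + \<bar>0\<bar>)"
    by (simp add: x mult.assoc)
qed (auto simp: inj_on_def)

subsection \<open>The auxiliary theta functions\<close>

text \<open>The summand of the weight \<open>T\<close> with \<open>s = r^2\<close>; the square root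
  \<open>r\<close> removes the division from the exponent \<open>b(b-1)/2\<close>.\<close>

definition theta_term :: "nat \<Rightarrow> complex \<Rightarrow> int \<Rightarrow> int \<Rightarrow> complex" where
  "theta_term e r a b = r powi (2 * a * a + 2 * int e * a + b * b - b)"

definition theta3 :: "nat \<Rightarrow> complex \<Rightarrow> int \<Rightarrow> complex" where
  "theta3 e r n = (\<Sum>\<^sub>\<infinity>a. theta_term e r a (n - a))"

text \<open>Applying \<open>int_square_ge\<close> to \<open>a\<close> with weight 4 and to
  \<open>b\<close> with weight 2 costs the constant \<open>4 + 2 = 6\<close>; the linear terms use
  up half of each gain.\<close>

lemma theta_exponent_bound:
  assumes "e \<le> 1"
  shows "4 * \<bar>a\<bar> + 2 * \<bar>b\<bar> \<le> 2 * (2 * a * a + 2 * int e * a + b * b - b) + (6 :: int)"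
proof -
  have "int e * a \<ge> - \<bar>a\<bar>"
    using assms by (cases "e = 0") (auto simp: le_Suc_eq)
  moreover have "2 * (2 * a * a + 2 * int e * a + b * b - b) = 4 * (a * a) + 4 * (int e * a) + 2 * (b * b) - 2 * b"
    by (simp add: algebra_simps)
  ultimately show ?thesis
    using int_square_ge[of a] int_square_ge[of b] abs_ge_self[of b] by linarith
qed

lemma theta_term_bound:
  assumes r: "r \<noteq> 0" "norm r < 1" and e: "e \<le> 1"
  shows "norm (theta_term e r a (n - a))
    \<le> sqrt (norm r) powi (- 6) * sqrt (norm r) ^ nat \<bar>n\<bar> * sqrt (norm r) ^ nat \<bar>a\<bar>"
proof -
  have "norm (theta_term e r a (n - a)) \<le> sqrt (norm r) powi (- 6) * sqrt (norm r) ^ nat (\<bar>n\<bar> + \<bar>a\<bar>)"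
    unfolding theta_term_def
  proof (rule norm_powi_bound[OF r])
    have weaken: "z + y \<le> 4 * y + 2 * x" if "z \<le> x + y" "0 \<le> x" "0 \<le> y" for x y z :: int
      using that by linarith
    have "\<bar>n\<bar> + \<bar>a\<bar> \<le> 4 * \<bar>a\<bar> + 2 * \<bar>n - a\<bar>"
      using abs_triangle_ineq[of "n - a" a] by (intro weaken) auto
    also note theta_exponent_bound[OF e, of a "n - a"]
    finally show "\<bar>n\<bar> + \<bar>a\<bar> \<le> 2 * (2 * a * a + 2 * int e * a + (n - a) * (n - a) - (n - a)) + 6" .
  qed simp
  then show ?thesis by (simp add: nat_add_distrib power_add mult.assoc)
qed

lemma summable_on_theta3:
  assumes r: "r \<noteq> 0" "norm r < 1" and e: "e \<le> 1"
  shows "(\<lambda>a. theta_term e r a (n - a)) summable_on UNIV"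
proof -
  have g: "(\<lambda>a::int. sqrt (norm r) powi (- 6) * sqrt (norm r) ^ nat \<bar>n\<bar> * sqrt (norm r) ^ nat \<bar>a\<bar>) summable_on UNIV"
    by (intro summable_on_cmult_right summable_on_power_abs_int) (use r in auto)
  show ?thesis
    by (rule abs_summable_summable, rule Infinite_Sum.abs_summable_on_comparison_test'[OF g])
       (rule theta_term_bound[OF r e])
qed

lemma theta3_bound:
  assumes r: "r \<noteq> 0" "norm r < 1" and e: "e \<le> 1"
  obtains K where "\<And>n. norm (theta3 e r n) \<le> K * sqrt (norm r) ^ nat \<bar>n\<bar>"
proof -
  define d where "d = sqrt (norm r)"
  define K where "K = d powi (- 6) * (\<Sum>\<^sub>\<infinity>a::int. d ^ nat \<bar>a\<bar>)"
  have d: "0 < d" "d < 1" using r by (auto simp: d_def)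
  have sum: "(\<lambda>a::int. d ^ nat \<bar>a\<bar>) summable_on UNIV"
    using d by (intro summable_on_power_abs_int) auto
  have "norm (theta3 e r n) \<le> K * d ^ nat \<bar>n\<bar>" for n
  proof -
    have "norm (theta3 e r n) \<le> (\<Sum>\<^sub>\<infinity>a. d powi (- 6) * d ^ nat \<bar>n\<bar> * d ^ nat \<bar>a\<bar>)"
      unfolding theta3_def
    proof (rule norm_infsum_le)
      show "((\<lambda>a. theta_term e r a (n - a)) has_sum (\<Sum>\<^sub>\<infinity>a. theta_term e r a (n - a))) UNIV"
        by (intro has_sum_infsum summable_on_theta3 assms)
      show "((\<lambda>a. d powi (- 6) * d ^ nat \<bar>n\<bar> * d ^ nat \<bar>a\<bar>) has_sum
          (\<Sum>\<^sub>\<infinity>a. d powi (- 6) * d ^ nat \<bar>n\<bar> * d ^ nat \<bar>a\<bar>)) (UNIV :: int set)"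
        by (intro has_sum_infsum summable_on_cmult_right sum)
    qed (use theta_term_bound[OF r e] in \<open>simp add: d_def\<close>)
    also have "\<dots> = K * d ^ nat \<bar>n\<bar>" by (simp add: infsum_cmult_right' K_def)
    finally show ?thesis .
  qed
  then show ?thesis using that by (auto simp: d_def)
qed

section \<open>The functional behind \<open>S3\<close> and \<open>S4\<close>, evaluated at the theta
  weight\<close>

definition U_sum :: "nat \<Rightarrow> complex \<Rightarrow> (int \<Rightarrow> complex) \<Rightarrow> complex" where
  "U_sum e s t = (\<Sum>\<^sub>\<infinity>(i, j). fps_nth (dil (s ^ e) (qG s)) i * qinv (s\<^sup>2) j * t (int i + 2 * int j))"

lemma U_coeff_bounded:
  assumes "norm s < 1"
  obtains C where "\<And>i. norm (fps_nth (dil (s ^ e) (qG s)) i) \<le> C"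
proof -
  obtain C where C: "\<And>i. norm (qinv (s\<^sup>2) i) \<le> C" "C > 0"
    using qinv_bounded[OF norm_power2_less_1[OF assms]] by blast
  have le1: "norm (s ^ n) \<le> 1" for n unfolding norm_power using assms by (intro power_le_one) auto
  have "norm (fps_nth (dil (s ^ e) (qG s)) i) \<le> 1 * (1 * C)" for i
    unfolding dil_nth qG_nth norm_mult power_mult[symmetric]
    by (intro mult_mono le1 C) (use C in auto)
  then show ?thesis using that by blast
qed

text \<open>The indices \<open>i, l, a, b\<close> with \<open>a + b = i + l\<close> decouple once \<open>m = a - i = l - b\<close> is held fixed.\<close>

lemma U_sum_theta3:
  fixes r :: complex
  assumes r: "r \<noteq> 0" "norm r < 1" and e: "e \<le> 1"
  defines "s \<equiv> r\<^sup>2"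
  shows "U_sum e s (theta3 e r) = qpoch_inf (s\<^sup>2) (s\<^sup>2) * qpoch_inf (- 1) s
    * (\<Sum>\<^sub>\<infinity>m. s powi (int m * int m + int e * int m) * qinv s m)"
proof -
  have s: "s \<noteq> 0" "norm s < 1" using r norm_power2_less_1[of r] by (auto simp: s_def)
  have e01: "e = 0 \<or> e = 1" using e by auto
  obtain K where K: "\<And>n. norm (theta3 e r n) \<le> K * sqrt (norm r) ^ nat \<bar>n\<bar>"
    using theta3_bound[OF r e] by blast
  obtain C where C: "\<And>n. norm (qinv s n) \<le> C" "C > 0" using qinv_bounded[OF s(2)] by blast
  obtain D where D: "\<And>n. norm (qinv (s\<^sup>2) n) \<le> D" "D > 0"
    using qinv_bounded[OF norm_power2_less_1[OF s(2)]] by blast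
  obtain B where B: "\<And>i. norm (fps_nth (dil (s ^ e) (qG s)) i) \<le> B"
    using U_coeff_bounded[OF s(2)] by blast
  have d: "0 \<le> sqrt (norm r)" "sqrt (norm r) < 1" using r by auto
  have spread_le: "norm (fps_nth (spread (qE (s\<^sup>2))) j) \<le> D" for j
    using D by (auto simp: spread_nth intro: less_imp_le)
  have dil_le: "norm (fps_nth (dil (- (s ^ (1 - e))) (qE (s\<^sup>2))) j) \<le> D" for j
  proof -
    have "norm ((- (s ^ (1 - e))) ^ j) \<le> 1"
      unfolding norm_power norm_minus_cancel using s(2) by (intro power_le_one) (auto intro: power_le_one)
    then have "norm ((- (s ^ (1 - e))) ^ j) * norm (qinv (s\<^sup>2) j) \<le> 1 * D"
      using D by (intro mult_mono) auto
    then show ?thesis by (simp add: norm_mult)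
  qed
  \<comment> \<open>At the weight \<open>t n = z^n\<close> the functional is formally
    \<open>(-s^e z;s^2)_inf / (z^2;s^2)_inf\<close>. Rewriting this series by
    \<open>qG_mult_spread\<close> replaces the indices by \<open>l\<close> in base \<open>s\<close>
    and \<open>i\<close> in base \<open>s^2\<close>.\<close>
  have "U_sum e s (theta3 e r)
      = (\<Sum>\<^sub>\<infinity>(i, j). fps_nth (dil (s ^ e) (qG s)) i * fps_nth (qE (s\<^sup>2)) j * theta3 e r (int (i + 2 * j)))"
    unfolding U_sum_def by simp
  also have "\<dots> = (\<Sum>\<^sub>\<infinity>(i, j). fps_nth (dil (s ^ e) (qG s)) i * fps_nth (spread (qE (s\<^sup>2))) j * theta3 e r (int (i + j)))"
    by (rule infsum_pair_spread)
  also have "\<dots> = (\<Sum>\<^sub>\<infinity>n. fps_nth (dil (s ^ e) (qG s) * spread (qE (s\<^sup>2))) n * theta3 e r (int n))"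
    by (rule infsum_fps_mult, rule summable_on_decaying[OF d B spread_le K]) auto
  also have "dil (s ^ e) (qG s) * spread (qE (s\<^sup>2)) = qE s * dil (- (s ^ (1 - e))) (qE (s\<^sup>2))"
    by (rule qG_mult_spread[OF s(2) e01])
  also have "(\<Sum>\<^sub>\<infinity>n. fps_nth (qE s * dil (- (s ^ (1 - e))) (qE (s\<^sup>2))) n * theta3 e r (int n))
      = (\<Sum>\<^sub>\<infinity>(l, i). fps_nth (qE s) l * fps_nth (dil (- (s ^ (1 - e))) (qE (s\<^sup>2))) i * theta3 e r (int (l + i)))"
    by (rule infsum_fps_mult[symmetric], rule summable_on_decaying[OF d _ dil_le K]) (use C in auto)
  also have "\<dots> = (\<Sum>\<^sub>\<infinity>(l, i). qinv s l * ((- (s ^ (1 - e))) ^ i * qinv (s\<^sup>2) i) * theta3 e r (int l + int i))"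
    by simp
  finally have U1: "U_sum e s (theta3 e r)
      = (\<Sum>\<^sub>\<infinity>(l, i). qinv s l * ((- (s ^ (1 - e))) ^ i * qinv (s\<^sup>2) i) * theta3 e r (int l + int i))" .
  define F :: "int \<Rightarrow> nat \<times> nat \<Rightarrow> complex" where
    "F = (\<lambda>m (l, i). qinv s l * ((- (s ^ (1 - e))) ^ i * qinv (s\<^sup>2) i) * theta_term e r (m + int i) (int l - m))"
  have summ: "(\<lambda>(m, x). F m x) summable_on UNIV \<times> UNIV"
  proof (rule summable_on_powi_bound[OF r, where u = "\<lambda>(m, l, i). m + int i" and v = "\<lambda>(m, l, i). int l - m"
        and w = "\<lambda>(m, l, i). int i" and C = "C * D"
        and E = "\<lambda>(m, l, i). 2 * (m + int i) * (m + int i) + 2 * int e * (m + int i) + (int l - m) * (int l - m) - (int l - m)"])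
    fix x :: "int \<times> nat \<times> nat"
    obtain m l i where x: "x = (m, l, i)" by (cases x) auto
    have "norm (qinv s l * ((- (s ^ (1 - e))) ^ i * qinv (s\<^sup>2) i)) \<le> C * D"
      unfolding norm_mult using dil_le[of i] C D by (intro mult_mono) (auto simp: norm_mult)
    then show "norm (case x of (m, x) \<Rightarrow> F m x) \<le> C * D * norm (r powi (case x of (m, l, i) \<Rightarrow>
        2 * (m + int i) * (m + int i) + 2 * int e * (m + int i) + (int l - m) * (int l - m) - (int l - m)))"
      unfolding x prod.case F_def theta_term_def by (subst norm_mult) (intro mult_right_mono norm_ge_zero)
    have weaken: "y + z + k \<le> 4 * y + 2 * z" if "k \<le> y + z" "0 \<le> y" "0 \<le> z" for k y z :: int
      using that by linarith
    have "\<bar>m + int i\<bar> + \<bar>int l - m\<bar> + int i \<le> 4 * \<bar>m + int i\<bar> + 2 * \<bar>int l - m\<bar>"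
      using abs_triangle_ineq[of "m + int i" "int l - m"] by (intro weaken) auto
    also note theta_exponent_bound[OF e, of "m + int i" "int l - m"]
    finally show "\<bar>case x of (m, l, i) \<Rightarrow> m + int i\<bar> + \<bar>case x of (m, l, i) \<Rightarrow> int l - m\<bar> + \<bar>case x of (m, l, i) \<Rightarrow> int i\<bar>
      \<le> 2 * (case x of (m, l, i) \<Rightarrow> 2 * (m + int i) * (m + int i) + 2 * int e * (m + int i) + (int l - m) * (int l - m) - (int l - m)) + 6"
      unfolding x prod.case by simp
  qed (use C D in \<open>auto simp: inj_on_def\<close>)
  have inner: "qinv s l * ((- (s ^ (1 - e))) ^ i * qinv (s\<^sup>2) i) * theta3 e r (int l + int i) = (\<Sum>\<^sub>\<infinity>m. F m (l, i))" for l i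
  proof -
    have "theta3 e r (int l + int i) = (\<Sum>\<^sub>\<infinity>m. theta_term e r (m + int i) (int l - m))"
      unfolding theta3_def by (subst infsum_int_shift[symmetric, of _ "int i"]) (simp add: algebra_simps)
    then show ?thesis by (simp add: F_def infsum_cmult_right')
  qed
  have "U_sum e s (theta3 e r) = (\<Sum>\<^sub>\<infinity>x. \<Sum>\<^sub>\<infinity>m. F m x)"
    unfolding U1 by (intro infsum_cong) (simp only: split_paired_all prod.case inner)
  also have "\<dots> = (\<Sum>\<^sub>\<infinity>m. \<Sum>\<^sub>\<infinity>x. F m x)"
    by (rule infsum_swap_banach[OF summ, symmetric])
  \<comment> \<open>For fixed \<open>m\<close> the exponent splits into a part in \<open>i\<close>
    and a part in \<open>l\<close>. The sum over \<open>i\<close> is an Euler tail, and the sum over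
    \<open>l\<close> is a theta series shifted by \<open>m\<close>.\<close>
  also have "\<dots> = (\<Sum>\<^sub>\<infinity>m. s powi (m * m + int e * m) * euler_tail s m
      * (\<Sum>\<^sub>\<infinity>l. r powi ((int l - m) * (int l - m) - (int l - m)) * qinv s l))"
  proof (rule infsum_cong)
    fix m :: int
    have eq: "F m (l, i) = (r powi ((int l - m) * (int l - m) - (int l - m)) * qinv s l) * (s powi (m * m + int e * m) *
        ((- 1) ^ i * s powi (int i * int i + int i + 2 * m * int i) * qinv (s\<^sup>2) i))" for l i
    proof -
      have "(- (s ^ (1 - e))) ^ i = (- 1) ^ i * s powi ((1 - int e) * int i)"
        using e01 by (auto simp: power_minus[of s])
      moreover have "s powi ((1 - int e) * int i) * theta_term e r (m + int i) (int l - m)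
          = r powi ((int l - m) * (int l - m) - (int l - m)) * (s powi (m * m + int e * m) * s powi (int i * int i + int i + 2 * m * int i))"
      proof -
        have spow: "s powi n = r powi (2 * n)" for n by (simp add: s_def power_int_mult)
        show ?thesis unfolding spow theta_term_def using r(1)
          by (simp only: power_int_add[symmetric] simp_thms) (simp add: algebra_simps)
      qed
      ultimately show ?thesis by (simp add: F_def mult_ac)
    qed
    have "F m summable_on UNIV"
      using summable_on_SigmaD1[OF summ, of m] by simp
    then have "(\<Sum>\<^sub>\<infinity>x. F m x) = (\<Sum>\<^sub>\<infinity>l. \<Sum>\<^sub>\<infinity>i. F m (l, i))"
      by (subst infsum_Sigma_banach) simp_all
    also have "\<dots> = (\<Sum>\<^sub>\<infinity>l. r powi ((int l - m) * (int l - m) - (int l - m)) * qinv s l * (s powi (m * m + int e * m) * euler_tail s m))"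
      unfolding eq using infsumI[OF has_sum_euler_tail[OF s, of m]] by (simp add: infsum_cmult_right')
    also have "\<dots> = s powi (m * m + int e * m) * euler_tail s m
        * (\<Sum>\<^sub>\<infinity>l. r powi ((int l - m) * (int l - m) - (int l - m)) * qinv s l)"
      by (subst infsum_cmult_left') (simp add: mult.commute)
    finally show "(\<Sum>\<^sub>\<infinity>x. F m x) = s powi (m * m + int e * m) * euler_tail s m
        * (\<Sum>\<^sub>\<infinity>l. r powi ((int l - m) * (int l - m) - (int l - m)) * qinv s l)" .
  qed
  also have "\<dots> = (\<Sum>\<^sub>\<infinity>m. s powi (int m * int m + int e * int m) * euler_tail s (int m)
      * (\<Sum>\<^sub>\<infinity>l. r powi ((int l - int m) * (int l - int m) - (int l - int m)) * qinv s l))"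
    by (rule infsum_int_nonneg) (simp add: euler_tail_def)
  \<comment> \<open>The shift \<open>m\<close> is now a natural number, so the sum over
    \<open>l\<close> has the closed form of \<open>has_sum_shifted_theta\<close>. Its factor
    \<open>(-s;s)_m\<close> turns \<open>1/(s^2;s^2)_m\<close> into \<open>1/(s;s)_m\<close>,
    leaving the Rogers-Ramanujan series.\<close>
  also have "\<dots> = (\<Sum>\<^sub>\<infinity>m. qpoch_inf (s\<^sup>2) (s\<^sup>2) * qpoch_inf (- 1) s * (s powi (int m * int m + int e * int m) * qinv s m))"
  proof (rule infsum_cong)
    fix m :: nat
    have "(\<Sum>\<^sub>\<infinity>l. r powi ((int l - int m) * (int l - int m) - (int l - int m)) * qinv s l) = qpoch (- s) s m * qpoch_inf (- 1) s"
      using infsumI[OF has_sum_shifted_theta[OF r, of m]] by (simp add: s_def)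
    moreover have "qinv (s\<^sup>2) m * qpoch (- s) s m = qinv s m" by (rule qinv_square[OF s(2)])
    ultimately show "s powi (int m * int m + int e * int m) * euler_tail s (int m)
      * (\<Sum>\<^sub>\<infinity>l. r powi ((int l - int m) * (int l - int m) - (int l - int m)) * qinv s l)
      = qpoch_inf (s\<^sup>2) (s\<^sup>2) * qpoch_inf (- 1) s * (s powi (int m * int m + int e * int m) * qinv s m)"
      by (simp add: euler_tail_def mult_ac)
  qed
  finally show ?thesis by (simp add: infsum_cmult_right')
qed

section \<open>The functional behind \<open>S1\<close> and \<open>S2\<close>, evaluated at the theta
  weight\<close>

definition V_sum :: "nat \<Rightarrow> complex \<Rightarrow> (int \<Rightarrow> complex) \<Rightarrow> complex" where
  "V_sum e s t = (\<Sum>\<^sub>\<infinity>(i, j). s powi (int e * int i + int j * int j + (1 - int e) * int j)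
     * qinv (s\<^sup>2) i * qinv (s\<^sup>2) j * t (int i - int j))"

text \<open>Completing the square gives \<open>(2a + g + 1/2)^2 - (g + 1/2)^2\<close>. For even
  \<open>g\<close> a shift of \<open>a\<close> removes \<open>g\<close>; for odd \<open>g\<close>
  the reflection of \<open>a\<close> replaces \<open>g\<close> by \<open>- g - 1\<close>, which is
  even.\<close>

lemma infsum_odd_gaussian:
  fixes r :: complex
  assumes "r \<noteq> 0"
  shows "(\<Sum>\<^sub>\<infinity>a::int. r powi (4 * a * a + 2 * (2 * g + 1) * a))
       = r powi (- (g * g + g)) * (\<Sum>\<^sub>\<infinity>a::int. r powi (4 * a * a + 2 * a))"
proof -
  have even: "(\<Sum>\<^sub>\<infinity>a::int. r powi (4 * a * a + 2 * (2 * (2 * h) + 1) * a))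
       = r powi (- (2 * h * (2 * h) + 2 * h)) * (\<Sum>\<^sub>\<infinity>a::int. r powi (4 * a * a + 2 * a))" for h :: int
  proof -
    have "(\<Sum>\<^sub>\<infinity>a::int. r powi (4 * a * a + 2 * a)) = (\<Sum>\<^sub>\<infinity>a. r powi (4 * (a + h) * (a + h) + 2 * (a + h)))"
      by (rule infsum_int_shift[symmetric])
    also have "\<dots> = (\<Sum>\<^sub>\<infinity>a. r powi (2 * h * (2 * h) + 2 * h) * r powi (4 * a * a + 2 * (2 * (2 * h) + 1) * a))"
      using assms by (intro infsum_cong, subst power_int_add[symmetric]) (auto simp: algebra_simps)
    also have "\<dots> = r powi (2 * h * (2 * h) + 2 * h) * (\<Sum>\<^sub>\<infinity>a. r powi (4 * a * a + 2 * (2 * (2 * h) + 1) * a))"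
      by (rule infsum_cmult_right')
    finally show ?thesis using assms by (simp only: power_int_minus) simp
  qed
  show ?thesis
  proof (cases "even g")
    case True
    then obtain h where "g = 2 * h" by (elim evenE)
    then show ?thesis using even[of h] by simp
  next
    case False
    then obtain h where h: "g = 2 * h + 1" by (elim oddE)
    have "(\<Sum>\<^sub>\<infinity>a::int. r powi (4 * a * a + 2 * (2 * g + 1) * a))
        = (\<Sum>\<^sub>\<infinity>a::int. r powi (4 * a * a + 2 * (2 * (2 * (- h - 1)) + 1) * a))"
      by (subst infsum_int_reflect[symmetric, of _ 0]) (simp add: h algebra_simps)
    also have "\<dots> = r powi (- (g * g + g)) * (\<Sum>\<^sub>\<infinity>a::int. r powi (4 * a * a + 2 * a))"
      unfolding even by (simp add: h algebra_simps)
    finally show ?thesis .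
  qed
qed

text \<open>Parametrizing the even integers by \<open>- 2 * a\<close> and the odd ones by
  \<open>2 * a + 1\<close> gives both halves the same exponent.\<close>

lemma theta2_halves:
  assumes r: "r \<noteq> 0" "norm r < 1"
  shows "theta2 r = 2 * (\<Sum>\<^sub>\<infinity>a::int. r powi (4 * a * a + 2 * a))"
proof -
  let ?f = "\<lambda>b::int. r powi (b * b - b)"
  let ?A = "range (\<lambda>a::int. - 2 * a)" and ?B = "range (\<lambda>a::int. 2 * a + 1)"
  have union: "?A \<union> ?B = UNIV"
  proof -
    have "b \<in> ?A \<union> ?B" for b :: int
    proof (cases "even b")
      case True
      then obtain a where "b = - 2 * (- a)" by (auto elim: evenE)
      then show ?thesis by blast
    qed (auto elim: oddE)
    then show ?thesis by blast
  qed
  have disjoint: "?A \<inter> ?B = {}" by (auto, presburger)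
  have summ: "?f summable_on X" for X
    by (rule summable_on_subset_banach[OF summable_on_theta2[OF r]]) simp
  have "theta2 r = infsum ?f ?A + infsum ?f ?B"
    unfolding theta2_def using infsum_Un_disjoint[OF summ summ disjoint] union by simp
  moreover have "infsum ?f ?A = (\<Sum>\<^sub>\<infinity>a::int. r powi (4 * a * a + 2 * a))"
    by (subst infsum_reindex) (auto simp: inj_on_def o_def algebra_simps)
  moreover have "infsum ?f ?B = (\<Sum>\<^sub>\<infinity>a::int. r powi (4 * a * a + 2 * a))"
    by (subst infsum_reindex) (auto simp: inj_on_def o_def algebra_simps)
  ultimately show ?thesis by simp
qed

text \<open>The theta factor that remains in \<open>V_sum\<close> once the Euler tail is expanded
  over \<open>l\<close> and \<open>c = - j - l\<close> becomes the summation variable.\<close>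

definition base_term :: "nat \<Rightarrow> complex \<Rightarrow> int \<Rightarrow> complex" where
  "base_term e r c = r powi (2 * c * c - 2 * (1 - int e) * c)"

lemma base_exponent_bound:
  assumes "e \<le> 1"
  shows "4 * \<bar>c\<bar> \<le> 2 * (2 * c * c - 2 * (1 - int e) * c) + (4 :: int)"
proof -
  have "(1 - int e) * c \<le> \<bar>c\<bar>"
    using assms by (cases "e = 0") (auto simp: le_Suc_eq)
  moreover have "2 * (2 * c * c - 2 * (1 - int e) * c) = 4 * (c * c) - 4 * ((1 - int e) * c)"
    by (simp add: algebra_simps)
  ultimately show ?thesis using int_square_ge[of c] by linarith
qed

text \<open>With \<open>D = c - a + k\<close> the second theta index \<open>c + 2 * k - a\<close>
  becomes \<open>D + k\<close>, free of \<open>a\<close>. The sum over \<open>a\<close> is then an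
  odd Gaussian, and after it the dependence on \<open>k\<close> separates as
  \<open>r powi (2 * k * k)\<close>.\<close>

lemma infsum_base_theta3:
  assumes r: "r \<noteq> 0" "norm r < 1" and e: "e \<le> 1"
  shows "(\<Sum>\<^sub>\<infinity>c. base_term e r c * theta3 e r (c + 2 * k)) = r powi (2 * k * k) * (theta2 r / 2) * theta2 (r\<^sup>2)"
proof -
  have e01: "e = 0 \<or> e = 1" using e by auto
  define E where "E = (\<lambda>c a. 2 * a * a + 2 * int e * a + (c + 2 * k - a) * (c + 2 * k - a) - (c + 2 * k - a)
      + (2 * c * c - 2 * (1 - int e) * c))"
  have summ: "(\<lambda>(c, a). r powi E c a) summable_on UNIV \<times> UNIV"
  proof (rule summable_on_powi_bound[OF r, where u = fst and v = snd and w = "\<lambda>_. 0" and C = 1 and E = "\<lambda>(c, a). E c a"])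
    fix x :: "int \<times> int"
    obtain c a where x: "x = (c, a)" by force
    have weaken: "y + z \<le> 2 * (E1 + E2) + 10"
      if "4 * z + 2 * u \<le> 2 * E1 + 6" "4 * y \<le> 2 * E2 + 4" "0 \<le> u" "0 \<le> y" "0 \<le> z" for y z u E1 E2 :: int
      unfolding distrib_left using that by linarith
    have "\<bar>c\<bar> + \<bar>a\<bar> \<le> 2 * E c a + 10"
      unfolding E_def
      by (rule weaken[OF theta_exponent_bound[OF e, of a "c + 2 * k - a"] base_exponent_bound[OF e, of c]]) auto
    then show "\<bar>fst x\<bar> + \<bar>snd x\<bar> + \<bar>0\<bar> \<le> 2 * (case x of (c, a) \<Rightarrow> E c a) + 10" by (simp add: x)
  qed (auto simp: inj_on_def)
  have "(\<Sum>\<^sub>\<infinity>c. base_term e r c * theta3 e r (c + 2 * k)) = (\<Sum>\<^sub>\<infinity>c. \<Sum>\<^sub>\<infinity>a. r powi E c a)"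
    unfolding theta3_def infsum_cmult_right'[symmetric] base_term_def theta_term_def E_def using r(1)
    by (intro infsum_cong) (simp add: power_int_add mult.commute)
  also have "\<dots> = (\<Sum>\<^sub>\<infinity>(c, a). r powi E c a)"
    using infsum_Sigma_banach[OF summ] by simp
  also have "\<dots> = (\<Sum>\<^sub>\<infinity>(D, a). r powi E (a + D - k) a)"
    by (rule infsum_reindex_bij_witness[of _ "\<lambda>(D, a). (a + D - k, a)" "\<lambda>(c, a). (c - a + k, a)"]) auto
  also have "\<dots> = (\<Sum>\<^sub>\<infinity>D. \<Sum>\<^sub>\<infinity>a. r powi E (a + D - k) a)"
  proof -
    have "(\<lambda>(D, a). r powi E (a + D - k) a) summable_on UNIV"
      using summ unfolding UNIV_Times_UNIV
      by (subst summable_on_reindex_bij_witness[of _ "\<lambda>(c, a). (c - a + k, a)" "\<lambda>(D, a). (a + D - k, a)" _ "\<lambda>(c, a). r powi E c a"]) auto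
    then show ?thesis using infsum_Sigma_banach[of "\<lambda>(D, a). r powi E (a + D - k) a" UNIV "\<lambda>_. UNIV"] by simp
  qed
  also have "\<dots> = (\<Sum>\<^sub>\<infinity>D. r powi (2 * k * k) * (theta2 r / 2) * (r\<^sup>2) powi (D * D - D))"
  proof (rule infsum_cong)
    fix D
    \<comment> \<open>Here \<open>c = a + d\<close>. The linear coefficient of \<open>a\<close> in
      the exponent is \<open>2 * (2 * g + 1)\<close>, and \<open>R\<close> collects what is free of
      \<open>a\<close>.\<close>
    define d g where "d = D - k" and "g = d + int e - 1"
    define R where "R = 3 * d * d - 2 * (1 - int e) * d + 4 * k * d + 4 * k * k - d - 2 * k"
    have "r powi E (a + D - k) a = r powi R * r powi (4 * a * a + 2 * (2 * g + 1) * a)" for a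
      using r(1) by (subst power_int_add[symmetric]) (auto simp: E_def R_def g_def d_def algebra_simps)
    then have "(\<Sum>\<^sub>\<infinity>a. r powi E (a + D - k) a) = r powi R * (r powi (- (g * g + g)) * (theta2 r / 2))"
      by (simp only: infsum_cmult_right' infsum_odd_gaussian[OF r(1)]) (simp add: theta2_halves[OF r])
    also have "\<dots> = r powi (R + - (g * g + g)) * (theta2 r / 2)"
      using r(1) by (simp only: power_int_add simp_thms mult.assoc)
    also have "R + - (g * g + g) = 2 * k * k + 2 * (D * D - D)"
      using e01 by (auto simp: R_def g_def d_def algebra_simps)
    also have "r powi (2 * k * k + 2 * (D * D - D)) = r powi (2 * k * k) * (r\<^sup>2) powi (D * D - D)"
      using r(1) by (simp only: power_int_add power_int_mult power_int_numeral simp_thms)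
    finally show "(\<Sum>\<^sub>\<infinity>a. r powi E (a + D - k) a)
        = r powi (2 * k * k) * (theta2 r / 2) * (r\<^sup>2) powi (D * D - D)" by (simp add: mult_ac)
  qed
  also have "\<dots> = r powi (2 * k * k) * (theta2 r / 2) * theta2 (r\<^sup>2)"
    unfolding theta2_def by (rule infsum_cmult_right')
  finally show ?thesis .
qed

text \<open>Multiplying by \<open>(s^2;s^2)_inf\<close> turns \<open>1/(s^2;s^2)_j\<close> into an
  Euler tail. Its expansion index \<open>l\<close> joins with \<open>i\<close> through
  \<open>1/((z;s^2)_inf (-z;s^2)_inf) = 1/(z^2;s^4)_inf\<close>, which is where the base
  \<open>s^4\<close> comes from.\<close>

lemma V_sum_theta3:
  fixes r :: complex
  assumes r: "r \<noteq> 0" "norm r < 1" and e: "e \<le> 1"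
  defines "s \<equiv> r\<^sup>2"
  shows "qpoch_inf (s\<^sup>2) (s\<^sup>2) * V_sum e s (theta3 e r) = theta2 r / 2 * theta2 s
    * (\<Sum>\<^sub>\<infinity>k. s powi (int k * int k + 2 * int e * int k) * qinv ((s\<^sup>2)\<^sup>2) k)"
proof -
  have s: "s \<noteq> 0" "norm s < 1" using r norm_power2_less_1[of r] by (auto simp: s_def)
  have p: "norm (s\<^sup>2) < 1" by (intro norm_power2_less_1 s)
  have e01: "e = 0 \<or> e = 1" using e by auto
  define d where "d = sqrt (norm r)"
  have d: "0 < d" "d < 1" using r by (auto simp: d_def)
  obtain K where K: "\<And>n. norm (theta3 e r n) \<le> K * d ^ nat \<bar>n\<bar>"
    using theta3_bound[OF r e] unfolding d_def by blast
  have K0: "0 \<le> K" using order_trans[OF norm_ge_zero K[of 0]] by simp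
  obtain D where D: "\<And>n. norm (qinv (s\<^sup>2) n) \<le> D" "D > 0"
    using qinv_bounded[OF p] by blast
  obtain B where B: "\<And>n. norm (qinv ((s\<^sup>2)\<^sup>2) n) \<le> B" "B > 0"
    using qinv_bounded[OF norm_power2_less_1[OF p]] by blast
  have spow: "s powi n = r powi (2 * n)" for n by (simp add: s_def power_int_mult)
  have spow_le: "norm (s ^ n) \<le> 1" for n
    unfolding norm_power using s(2) by (intro power_le_one) auto
  \<comment> \<open>More than one copy of \<open>|c|\<close> is kept in the exponent, because
    bounding the index \<open>n - c\<close> by \<open>|n|\<close> costs a further
    \<open>|c|\<close>.\<close>
  have base_theta_bound: "norm (base_term e r c * theta3 e r n) \<le> d powi (- 4) * K * d ^ nat (4 * \<bar>c\<bar> + \<bar>n\<bar>)" for c n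
  proof -
    have "norm (base_term e r c) \<le> d powi (- 4) * d ^ nat (4 * \<bar>c\<bar>)"
      unfolding base_term_def d_def by (intro norm_powi_bound r base_exponent_bound e) auto
    then have "norm (base_term e r c) * norm (theta3 e r n)
        \<le> d powi (- 4) * d ^ nat (4 * \<bar>c\<bar>) * (K * d ^ nat \<bar>n\<bar>)"
      using d by (intro mult_mono K) auto
    then show ?thesis by (simp add: norm_mult nat_add_distrib power_add mult_ac)
  qed
  define F :: "int \<Rightarrow> nat \<times> nat \<Rightarrow> complex" where
    "F = (\<lambda>c (i, l). fps_nth (qE (s\<^sup>2)) i * fps_nth (dil (- 1) (qE (s\<^sup>2))) l
        * (base_term e r c * (s ^ (e * (i + l)) * theta3 e r (c + int (i + l)))))"
  have summ: "(\<lambda>(c, x). F c x) summable_on UNIV \<times> UNIV"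
  proof (rule summable_on_geometric_bound[where d = d and u = "\<lambda>(c, i, l). c" and v = "\<lambda>(c, i, l). int i"
        and w = "\<lambda>(c, i, l). int l" and C = "D * D * (d powi (- 4) * K)"])
    fix x :: "int \<times> nat \<times> nat"
    obtain c i l where x: "x = (c, i, l)" by (cases x) auto
    have weaken: "y + k \<le> 4 * y + z" if "k \<le> y + z" "0 \<le> y" for y z k :: int
      using that by linarith
    have "\<bar>c\<bar> + int (i + l) \<le> 4 * \<bar>c\<bar> + \<bar>c + int (i + l)\<bar>"
      using abs_triangle_ineq[of "- c" "c + int (i + l)"] by (intro weaken) auto
    then have exp_le: "d ^ nat (4 * \<bar>c\<bar> + \<bar>c + int (i + l)\<bar>) \<le> d ^ nat (\<bar>c\<bar> + int (i + l))"
      using d by (intro power_decreasing) auto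
    have "norm (F c (i, l)) = norm (qinv (s\<^sup>2) i) * norm (qinv (s\<^sup>2) l)
        * (norm (s ^ (e * (i + l))) * norm (base_term e r c * theta3 e r (c + int (i + l))))"
      by (simp add: F_def norm_mult norm_power mult_ac)
    also have "\<dots> \<le> D * D * (1 * (d powi (- 4) * K * d ^ nat (4 * \<bar>c\<bar> + \<bar>c + int (i + l)\<bar>)))"
      using D d K0 by (intro mult_mono base_theta_bound spow_le D) auto
    also have "\<dots> \<le> D * D * (1 * (d powi (- 4) * K * d ^ nat (\<bar>c\<bar> + int (i + l))))"
      using D d K0 exp_le by (intro mult_left_mono) auto
    finally show "norm (case x of (c, x) \<Rightarrow> F c x) \<le> D * D * (d powi (- 4) * K)
      * d ^ nat (\<bar>case x of (c, i, l) \<Rightarrow> c\<bar> + \<bar>case x of (c, i, l) \<Rightarrow> int i\<bar> + \<bar>case x of (c, i, l) \<Rightarrow> int l\<bar>)"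
      by (simp add: x mult_ac add_ac)
  qed (use d in \<open>auto simp: inj_on_def\<close>)
  have summ2: "(\<lambda>(c, k). qinv ((s\<^sup>2)\<^sup>2) k * (base_term e r c * (s ^ (e * (2 * k)) * theta3 e r (c + int (2 * k)))))
      summable_on (UNIV :: int set) \<times> (UNIV :: nat set)"
  proof (rule summable_on_geometric_bound[where d = d and u = "\<lambda>(c, k). c" and v = "\<lambda>(c, k). int k"
        and w = "\<lambda>_. 0" and C = "B * (d powi (- 4) * K)"])
    fix x :: "int \<times> nat"
    obtain c k where x: "x = (c, k)" by (cases x) auto
    have weaken: "y + k \<le> 4 * y + z" if "2 * k \<le> y + z" "0 \<le> y" "0 \<le> k" for y z k :: int
      using that by linarith
    have "\<bar>c\<bar> + int k \<le> 4 * \<bar>c\<bar> + \<bar>c + int (2 * k)\<bar>"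
      using abs_triangle_ineq[of "- c" "c + int (2 * k)"] by (intro weaken) auto
    then have exp_le: "d ^ nat (4 * \<bar>c\<bar> + \<bar>c + int (2 * k)\<bar>) \<le> d ^ nat (\<bar>c\<bar> + int k)"
      using d by (intro power_decreasing) auto
    have "norm (qinv ((s\<^sup>2)\<^sup>2) k * (base_term e r c * (s ^ (e * (2 * k)) * theta3 e r (c + int (2 * k)))))
        = norm (qinv ((s\<^sup>2)\<^sup>2) k)
        * (norm (s ^ (e * (2 * k))) * norm (base_term e r c * theta3 e r (c + int (2 * k))))"
      by (simp add: norm_mult norm_power mult_ac)
    also have "\<dots> \<le> B * (1 * (d powi (- 4) * K * d ^ nat (4 * \<bar>c\<bar> + \<bar>c + int (2 * k)\<bar>)))"
      using B d K0 by (intro mult_mono base_theta_bound spow_le B) auto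
    also have "\<dots> \<le> B * (1 * (d powi (- 4) * K * d ^ nat (\<bar>c\<bar> + int k)))"
      using B d K0 exp_le by (intro mult_left_mono) auto
    finally show "norm (case x of (c, k) \<Rightarrow> qinv ((s\<^sup>2)\<^sup>2) k * (base_term e r c * (s ^ (e * (2 * k)) * theta3 e r (c + int (2 * k)))))
      \<le> B * (d powi (- 4) * K) * d ^ nat (\<bar>case x of (c, k) \<Rightarrow> c\<bar> + \<bar>case x of (c, k) \<Rightarrow> int k\<bar> + \<bar>0\<bar>)"
      by (simp add: x mult_ac)
  qed (use d in \<open>auto simp: inj_on_def\<close>)
  define H :: "nat \<Rightarrow> int \<Rightarrow> complex" where
    "H = (\<lambda>i j. theta3 e r (int i - j) * s ^ (e * i) * qinv (s\<^sup>2) i * s powi (j * j + (1 - int e) * j))"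
  \<comment> \<open>Once written with Euler tails, the sum over \<open>j\<close> can be extended to
    all integers, which makes the substitution \<open>c = - j - l\<close> a bijection.\<close>
  have "qpoch_inf (s\<^sup>2) (s\<^sup>2) * V_sum e s (theta3 e r) = (\<Sum>\<^sub>\<infinity>(i, j). H i (int j) * euler_tail s (int j))"
    unfolding V_sum_def infsum_cmult_right'[symmetric]
  proof (rule infsum_cong, clarify)
    fix i j :: nat
    have "s powi (int e * int i + int j * int j + (1 - int e) * int j)
        = s ^ (e * i) * s powi (int j * int j + (1 - int e) * int j)"
      using s(1) by (subst add.assoc, subst power_int_add) (auto simp flip: of_nat_mult)
    then show "qpoch_inf (s\<^sup>2) (s\<^sup>2) * (s powi (int e * int i + int j * int j + (1 - int e) * int j)
      * qinv (s\<^sup>2) i * qinv (s\<^sup>2) j * theta3 e r (int i - int j)) = H i (int j) * euler_tail s (int j)"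
      by (simp add: H_def euler_tail_def mult_ac)
  qed
  also have "\<dots> = (\<Sum>\<^sub>\<infinity>(i, j)\<in>range (map_prod id int). H i j * euler_tail s j)"
    by (subst infsum_reindex) (auto simp: inj_on_def o_def case_prod_unfold)
  also have "\<dots> = (\<Sum>\<^sub>\<infinity>(i, j). H i j * euler_tail s j)"
  proof (rule infsum_cong_neutral)
    fix x :: "nat \<times> int" assume x: "x \<in> UNIV - range (map_prod id int)"
    obtain i j where ij: "x = (i, j)" by force
    have "j < 0"
    proof (rule ccontr)
      assume "\<not> j < 0"
      then have "(i, j) = map_prod id int (i, nat j)" by simp
      then show False using x unfolding ij by (metis Diff_iff rangeI)
    qed
    then show "(case x of (i, j) \<Rightarrow> H i j * euler_tail s j) = 0" by (simp add: ij euler_tail_def)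
  qed auto
  also have "\<dots> = (\<Sum>\<^sub>\<infinity>(i, j). \<Sum>\<^sub>\<infinity>l. F (- j - int l) (i, l))"
  proof (rule infsum_cong, clarify)
    fix i :: nat and j :: int
    have "H i j * ((- 1) ^ l * s powi (int l * int l + int l + 2 * j * int l) * qinv (s\<^sup>2) l) = F (- j - int l) (i, l)" for l
    proof -
      have "s powi (j * j + (1 - int e) * j) * s powi (int l * int l + int l + 2 * j * int l)
          = base_term e r (- j - int l) * s powi (int e * int l)"
        unfolding spow base_term_def using r(1)
        by (simp only: power_int_add[symmetric] simp_thms) (simp add: algebra_simps)
      also have "s powi (int e * int l) = s ^ (e * l)" by (simp flip: of_nat_mult)
      finally show ?thesis
        by (simp add: H_def F_def power_add distrib_left mult_ac)
    qed
    then show "H i j * euler_tail s j = (\<Sum>\<^sub>\<infinity>l. F (- j - int l) (i, l))"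
      using infsumI[OF has_sum_cmult_right[OF has_sum_euler_tail[OF s, of j], of "H i j"]] by simp
  qed
  also have "\<dots> = (\<Sum>\<^sub>\<infinity>((i, j), l). F (- j - int l) (i, l))"
  proof -
    have "(\<lambda>((i, j), l). F (- j - int l) (i, l)) summable_on UNIV"
      using summ unfolding UNIV_Times_UNIV
      by (subst summable_on_reindex_bij_witness[of _ "\<lambda>(c, i, l). ((i, - c - int l), l)" "\<lambda>((i, j), l). (- j - int l, i, l)" _ "\<lambda>(c, x). F c x"]) auto
    then show ?thesis
      using infsum_Sigma_banach[of "\<lambda>((i, j), l). F (- j - int l) (i, l)" UNIV "\<lambda>_. UNIV"]
      by (simp add: case_prod_unfold)
  qed
  also have "\<dots> = (\<Sum>\<^sub>\<infinity>(c, x). F c x)"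
    by (rule infsum_reindex_bij_witness[of _ "\<lambda>(c, i, l). ((i, - c - int l), l)" "\<lambda>((i, j), l). (- j - int l, i, l)"]) auto
  also have "\<dots> = (\<Sum>\<^sub>\<infinity>c. \<Sum>\<^sub>\<infinity>x. F c x)"
    using infsum_Sigma_banach[OF summ] by simp
  \<comment> \<open>For fixed \<open>c\<close> the summand depends on \<open>i\<close> and
    \<open>l\<close> through \<open>i + l\<close> apart from the coefficients. By
    \<open>qE_signed\<close> only even totals \<open>2 * k\<close> survive.\<close>
  also have "\<dots> = (\<Sum>\<^sub>\<infinity>c. \<Sum>\<^sub>\<infinity>k. qinv ((s\<^sup>2)\<^sup>2) k * (base_term e r c * (s ^ (e * (2 * k)) * theta3 e r (c + int (2 * k)))))"
  proof (rule infsum_cong)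
    fix c
    have "F c summable_on UNIV" using summable_on_SigmaD1[OF summ, of c] by simp
    then have "(\<Sum>\<^sub>\<infinity>x. F c x) = (\<Sum>\<^sub>\<infinity>n. fps_nth (qE (s\<^sup>2) * dil (- 1) (qE (s\<^sup>2))) n
        * (base_term e r c * (s ^ (e * n) * theta3 e r (c + int n))))"
      unfolding F_def by (rule infsum_fps_mult)
    also have "\<dots> = (\<Sum>\<^sub>\<infinity>k. qinv ((s\<^sup>2)\<^sup>2) k * (base_term e r c * (s ^ (e * (2 * k)) * theta3 e r (c + int (2 * k)))))"
      unfolding qE_signed[OF p] infsum_spread by simp
    finally show "(\<Sum>\<^sub>\<infinity>x. F c x) = (\<Sum>\<^sub>\<infinity>k. qinv ((s\<^sup>2)\<^sup>2) k * (base_term e r c * (s ^ (e * (2 * k)) * theta3 e r (c + int (2 * k)))))" .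
  qed
  also have "\<dots> = (\<Sum>\<^sub>\<infinity>k. \<Sum>\<^sub>\<infinity>c. qinv ((s\<^sup>2)\<^sup>2) k * (base_term e r c * (s ^ (e * (2 * k)) * theta3 e r (c + int (2 * k)))))"
    by (rule infsum_swap_banach[OF summ2])
  also have "\<dots> = (\<Sum>\<^sub>\<infinity>k. theta2 r / 2 * theta2 s * (s powi (int k * int k + 2 * int e * int k) * qinv ((s\<^sup>2)\<^sup>2) k))"
  proof (rule infsum_cong)
    fix k
    have "(\<Sum>\<^sub>\<infinity>c. qinv ((s\<^sup>2)\<^sup>2) k * (base_term e r c * (s ^ (e * (2 * k)) * theta3 e r (c + int (2 * k)))))
        = (\<Sum>\<^sub>\<infinity>c. qinv ((s\<^sup>2)\<^sup>2) k * s ^ (e * (2 * k)) * (base_term e r c * theta3 e r (c + 2 * int k)))"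
      by (simp add: mult_ac)
    also have "\<dots> = qinv ((s\<^sup>2)\<^sup>2) k * s ^ (e * (2 * k)) * (r powi (2 * int k * int k) * (theta2 r / 2) * theta2 s)"
      unfolding infsum_cmult_right' infsum_base_theta3[OF r e] s_def ..
    also have "\<dots> = theta2 r / 2 * theta2 s * (s powi (int k * int k + 2 * int e * int k) * qinv ((s\<^sup>2)\<^sup>2) k)"
    proof -
      have "s ^ (e * (2 * k)) = s powi (2 * int e * int k)"
        by (subst power_int_of_nat[symmetric]) (simp add: mult_ac)
      moreover have "r powi (2 * int k * int k) = s powi (int k * int k)"
        by (simp add: spow mult.assoc)
      ultimately show ?thesis using s(1) by (simp add: power_int_add mult_ac)
    qed
    finally show "(\<Sum>\<^sub>\<infinity>c. qinv ((s\<^sup>2)\<^sup>2) k * (base_term e r c * (s ^ (e * (2 * k)) * theta3 e r (c + int (2 * k)))))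
        = theta2 r / 2 * theta2 s * (s powi (int k * int k + 2 * int e * int k) * qinv ((s\<^sup>2)\<^sup>2) k)" .
  qed
  also have "\<dots> = theta2 r / 2 * theta2 s * (\<Sum>\<^sub>\<infinity>k. s powi (int k * int k + 2 * int e * int k) * qinv ((s\<^sup>2)\<^sup>2) k)"
    by (rule infsum_cmult_right')
  finally show ?thesis .
qed

text \<open>With \<open>p = s^2\<close>, the quotient \<open>(-p;p)_inf / (p^2;p^2)_k\<close> equals
  \<open>(-p^(k+1);p)_inf / (p;p)_k\<close>. Expanding the numerator over \<open>j\<close> by Euler
  completes the exponent to \<open>(k+j)^2\<close> plus linear terms, and grouping by
  \<open>k + j\<close> gives the right-hand series.\<close>

lemma rogers_identity:
  assumes s: "s \<noteq> 0" "norm s < 1" and e: "e \<le> 1"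
  shows "qpoch_inf (- (s\<^sup>2)) (s\<^sup>2) * (\<Sum>\<^sub>\<infinity>k. s powi (int k * int k + 2 * int e * int k) * qinv ((s\<^sup>2)\<^sup>2) k)
    = (\<Sum>\<^sub>\<infinity>m. s powi (int m * int m + int e * int m) * qinv s m)"
proof -
  define p where "p = s\<^sup>2"
  have p: "norm p < 1" unfolding p_def by (intro norm_power2_less_1 s)
  obtain D where D: "\<And>n. norm (qinv p n) \<le> D" "D > 0" using qinv_bounded[OF p] by blast
  define f g where "f = dil (s ^ (2 * e)) (qE p)" and "g = dil s (qE p)"
  \<comment> \<open>The progressions in base \<open>s^2\<close> starting at \<open>s^(2e)\<close>
    and at \<open>s\<close> interlace to one in base \<open>s\<close> starting at
    \<open>s^e\<close>.\<close>
  have fg: "f * g = dil (s ^ e) (qE s)"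
  proof -
    have e01: "e = 0 \<or> e = 1" using e by auto
    have "qE s = qE p * dil s (qE p)" unfolding p_def by (rule qE_split[OF s(2)])
    then show ?thesis using e01
      by (auto simp: f_def g_def dil_mult dil_dil power2_eq_square mult.commute)
  qed
  have spow_le: "norm (s ^ n) \<le> 1" for n
    unfolding norm_power using s(2) by (intro power_le_one) auto
  have f: "norm (fps_nth f i) \<le> D" for i
    using mult_mono[OF spow_le[of "2 * e * i"] D(1)[of i]] D(2)
    by (simp add: f_def norm_mult power_mult)
  have g: "norm (fps_nth g i) \<le> D" for i
    using mult_mono[OF spow_le[of i] D(1)[of i]] D(2) by (simp add: g_def norm_mult)
  have summ: "(\<lambda>(k, j). fps_nth f k * fps_nth g j * s powi (int (k + j) * int (k + j))) summable_on UNIV"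
  proof (rule summable_on_powi_bound[OF s, where u = "\<lambda>(k, j). int k" and v = "\<lambda>(k, j). int j" and w = "\<lambda>_. 0"
        and C = "D * D" and E = "\<lambda>(k, j). int (k + j) * int (k + j)"])
    fix x :: "nat \<times> nat"
    obtain k j where x: "x = (k, j)" by force
    have "norm (fps_nth f k) * norm (fps_nth g j) \<le> D * D"
      using D(2) by (intro mult_mono f g) auto
    then show "norm (case x of (k, j) \<Rightarrow> fps_nth f k * fps_nth g j * s powi (int (k + j) * int (k + j)))
        \<le> D * D * norm (s powi (case x of (k, j) \<Rightarrow> int (k + j) * int (k + j)))"
      unfolding x prod.case norm_mult by (intro mult_right_mono norm_ge_zero)
    show "\<bar>case x of (k, j) \<Rightarrow> int k\<bar> + \<bar>case x of (k, j) \<Rightarrow> int j\<bar> + \<bar>0\<bar>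
        \<le> 2 * (case x of (k, j) \<Rightarrow> int (k + j) * int (k + j)) + 2"
      using int_square_ge[of "int (k + j)"] by (simp add: x)
  qed (use D in \<open>auto simp: inj_on_def\<close>)
  have "qpoch_inf (- p) p * (\<Sum>\<^sub>\<infinity>k. s powi (int k * int k + 2 * int e * int k) * qinv (p\<^sup>2) k)
      = (\<Sum>\<^sub>\<infinity>k. \<Sum>\<^sub>\<infinity>j. fps_nth f k * fps_nth g j * s powi (int (k + j) * int (k + j)))"
    unfolding infsum_cmult_right'[symmetric]
  proof (rule infsum_cong)
    fix k
    define x where "x = - (p ^ Suc k)"
    have "qpoch_inf (- p) p * qinv (p\<^sup>2) k = qinv p k * qpoch_inf x p"
      using qpoch_inf_split[OF p, of "- p" k] qinv_square[OF p, of k]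
      by (simp add: x_def mult_ac)
    then have "qpoch_inf (- p) p * (s powi (int k * int k + 2 * int e * int k) * qinv (p\<^sup>2) k)
        = s powi (int k * int k + 2 * int e * int k) * qinv p k * qpoch_inf x p" by (simp add: mult_ac)
    also have "\<dots> = (\<Sum>\<^sub>\<infinity>j. s powi (int k * int k + 2 * int e * int k) * qinv p k
        * ((- 1) ^ j * s powi (int j * int j - int j) * qinv p j * x ^ j))"
      using infsumI[OF has_sum_cmult_right[OF has_sum_qexp2_powi[OF s, of x]]] by (simp add: p_def)
    also have "\<dots> = (\<Sum>\<^sub>\<infinity>j. fps_nth f k * fps_nth g j * s powi (int (k + j) * int (k + j)))"
    proof (rule infsum_cong)
      fix j
      have "(- 1) ^ j * x ^ j = (p ^ Suc k) ^ j"
        unfolding x_def power_mult_distrib[symmetric] by simp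
      also have "\<dots> = s powi (2 * int (Suc k) * int j)"
        unfolding p_def by (simp only: power_int_mult power_int_of_nat power_int_numeral)
      finally have x_pow: "(- 1) ^ j * x ^ j = s powi (2 * int (Suc k) * int j)" .
      have expand: "s powi (int k * int k + 2 * int e * int k) * (s powi (int j * int j - int j) * s powi (2 * int (Suc k) * int j))
          = s powi (int (2 * e * k)) * s powi (int j) * s powi (int (k + j) * int (k + j))"
        using s(1) by (simp only: power_int_add[symmetric] simp_thms) (simp add: algebra_simps)
      have "s powi (int k * int k + 2 * int e * int k) * qinv p k
          * ((- 1) ^ j * s powi (int j * int j - int j) * qinv p j * x ^ j)
        = (s powi (int k * int k + 2 * int e * int k) * (s powi (int j * int j - int j) * ((- 1) ^ j * x ^ j)))
          * (qinv p k * qinv p j)"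
        by (simp only: mult_ac)
      also have "\<dots> = fps_nth f k * fps_nth g j * s powi (int (k + j) * int (k + j))"
        unfolding x_pow expand power_int_of_nat power_mult[of s "2 * e" k]
        by (simp add: f_def g_def mult_ac)
      finally show "s powi (int k * int k + 2 * int e * int k) * qinv p k
          * ((- 1) ^ j * s powi (int j * int j - int j) * qinv p j * x ^ j)
        = fps_nth f k * fps_nth g j * s powi (int (k + j) * int (k + j))" .
    qed
    finally show "qpoch_inf (- p) p * (s powi (int k * int k + 2 * int e * int k) * qinv (p\<^sup>2) k)
        = (\<Sum>\<^sub>\<infinity>j. fps_nth f k * fps_nth g j * s powi (int (k + j) * int (k + j)))" .
  qed
  also have "\<dots> = (\<Sum>\<^sub>\<infinity>(k, j). fps_nth f k * fps_nth g j * s powi (int (k + j) * int (k + j)))"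
    using infsum_Sigma_banach[of "\<lambda>(k, j). fps_nth f k * fps_nth g j * s powi (int (k + j) * int (k + j))" UNIV "\<lambda>_. UNIV"] summ
    by simp
  also have "\<dots> = (\<Sum>\<^sub>\<infinity>n. fps_nth (f * g) n * s powi (int n * int n))"
    by (rule infsum_fps_mult[OF summ])
  also have "\<dots> = (\<Sum>\<^sub>\<infinity>m. s powi (int m * int m + int e * int m) * qinv s m)"
  proof (rule infsum_cong)
    fix m
    have "s powi (int m * int m + int e * int m) = s powi (int m * int m) * (s ^ e) ^ m"
      using s(1) by (subst power_int_add) (auto simp flip: of_nat_mult power_mult)
    then show "fps_nth (f * g) m * s powi (int m * int m) = s powi (int m * int m + int e * int m) * qinv s m"
      by (simp add: fg mult_ac)
  qed
  finally show ?thesis by (simp add: p_def)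
qed

text \<open>In the notation of the proof, Gauss's product gives \<open>theta2 r = P * M\<close> and
  \<open>theta2 s = 2 * P * N^2\<close>. Rogers's identity absorbs one factor \<open>N\<close>; the
  other is the product in the claim.\<close>

lemma theta3_identity:
  fixes r :: complex
  assumes r: "r \<noteq> 0" "norm r < 1" and e: "e \<le> 1"
  defines "s \<equiv> r\<^sup>2"
  shows "qpoch_inf (- (s\<^sup>2)) (s\<^sup>2) * U_sum e s (theta3 e r) = V_sum e s (theta3 e r)"
proof -
  have s: "s \<noteq> 0" "norm s < 1" using r norm_power2_less_1[of r] by (auto simp: s_def)
  define p where "p = s\<^sup>2"
  have p: "norm p < 1" unfolding p_def by (intro norm_power2_less_1 s)
  define P N M A R where "P = qpoch_inf p p" and "N = qpoch_inf (- p) p" and "M = qpoch_inf (- 1) s"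
    and "A = (\<Sum>\<^sub>\<infinity>m. s powi (int m * int m + int e * int m) * qinv s m)"
    and "R = (\<Sum>\<^sub>\<infinity>k. s powi (int k * int k + 2 * int e * int k) * qinv (p\<^sup>2) k)"
  have "P \<noteq> 0" unfolding P_def by (intro qpoch_inf_nonzero' p)
  have U: "U_sum e s (theta3 e r) = P * M * A"
    unfolding P_def M_def A_def p_def s_def by (rule U_sum_theta3[OF r e])
  have V: "P * V_sum e s (theta3 e r) = theta2 r / 2 * theta2 s * R"
    unfolding P_def R_def p_def s_def by (rule V_sum_theta3[OF r e])
  have A: "N * R = A"
    unfolding N_def A_def R_def p_def by (rule rogers_identity[OF s e])
  have 1: "theta2 r = P * M"
    using qpoch_inf_square[OF s(2)] theta2_product[OF r] by (simp add: P_def M_def p_def s_def mult_ac)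
  have 2: "theta2 s = P * (2 * N) * N"
    using theta2_product[OF s] qpoch_inf_head[OF p, of "- 1"] by (simp add: P_def N_def p_def)
  have "P * V_sum e s (theta3 e r) = P * (N * (P * M * A))"
    unfolding V 1 2 A[symmetric] by simp
  then show ?thesis using \<open>P \<noteq> 0\<close> by (simp add: U N_def p_def)
qed

subsection \<open>Separation of residue classes\<close>

text \<open>The quadratic part \<open>2 a^2 + (n-a)^2 = 3 a^2 - 2 n a + n^2\<close> explains the
  period: under \<open>a -> a + 1\<close>, \<open>n -> n + 3\<close> the exponent changes by an
  amount free of \<open>a\<close>.\<close>

lemma theta3_add_3:
  assumes "r \<noteq> 0"
  shows "theta3 e r (n + 3) = r powi (4 * n + 4 + 2 * int e) * theta3 e r n"
proof -
  have "theta3 e r (n + 3) = (\<Sum>\<^sub>\<infinity>a. theta_term e r (a + 1) (n + 3 - (a + 1)))"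
    unfolding theta3_def by (rule infsum_int_shift[symmetric])
  also have "\<dots> = (\<Sum>\<^sub>\<infinity>a. r powi (4 * n + 4 + 2 * int e) * theta_term e r a (n - a))"
    unfolding theta_term_def using assms
    by (intro infsum_cong, subst power_int_add[symmetric]) (auto simp: algebra_simps)
  finally show ?thesis by (simp add: theta3_def infsum_cmult_right')
qed

text \<open>The map \<open>a -> - e - a\<close> fixes \<open>a^2 + e a\<close>, the map
  \<open>b -> 1 - b\<close> fixes \<open>b^2 - b\<close>, and together they send
  \<open>a + b = n\<close> to \<open>1 - e - n\<close>.\<close>

lemma theta3_reflect:
  assumes "r \<noteq> 0"
  shows "theta3 e r (1 - int e - n) = theta3 e r n"
proof -
  have "theta3 e r (1 - int e - n) = (\<Sum>\<^sub>\<infinity>a. theta_term e r (- int e - a) (1 - int e - n - (- int e - a)))"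
    unfolding theta3_def by (rule infsum_int_reflect[symmetric])
  also have "\<dots> = theta3 e r n"
    unfolding theta3_def theta_term_def by (intro infsum_cong) (simp add: algebra_simps)
  finally show ?thesis .
qed

definition wt :: "nat \<Rightarrow> complex \<Rightarrow> int \<Rightarrow> complex" where
  "wt e u n = u powi (n * n - (1 - int e) * n)"

definition wt_on :: "(int \<Rightarrow> bool) \<Rightarrow> nat \<Rightarrow> complex \<Rightarrow> int \<Rightarrow> complex" where
  "wt_on P e u n = (if P n then wt e u n else 0)"

text \<open>Modulo 3 the congruence \<open>1 - e - n = n\<close> has the single solution
  \<open>n = e - 1\<close>; the reflection exchanges the other two classes.\<close>

definition fixed_class :: "nat \<Rightarrow> int \<Rightarrow> bool" where
  "fixed_class e n \<longleftrightarrow> 3 dvd (n + 1 - int e)"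

lemma periodic_int:
  fixes f :: "int \<Rightarrow> 'a"
  assumes "\<And>n. f (n + 3) = f n"
  shows "f (n + 3 * k) = f n"
proof (induction k rule: int_induct[where k = 0])
  case (step1 i)
  have "f (n + 3 * (i + 1)) = f (n + 3 * i + 3)" by (simp add: algebra_simps)
  then show ?case using step1 assms by simp
next
  case (step2 i)
  have "n + 3 * (i - 1) + 3 = n + 3 * i" by simp
  then show ?case using step2 assms[of "n + 3 * (i - 1)"] by simp
qed simp

text \<open>With \<open>u = t^2\<close> and \<open>r = t^3\<close>, so that
  \<open>u^3 = r^2\<close>, the theta weight and \<open>wt\<close> acquire the same factor under
  \<open>n -> n + 3\<close> and are both invariant under reflection. Their ratio \<open>c\<close> is
  therefore constant on the fixed class and on the union of the other two.\<close>

lemma theta3_classes: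
  fixes t :: complex and e :: nat
  assumes t: "t \<noteq> 0"
  defines "c \<equiv> \<lambda>n. theta3 e (t ^ 3) n / wt e (t ^ 2) n"
  shows "theta3 e (t ^ 3) n = c (int e - 1) * wt_on (fixed_class e) e (t ^ 2) n
       + c (int e) * wt_on (\<lambda>n. \<not> fixed_class e n) e (t ^ 2) n"
proof -
  have wt_nz: "wt e (t ^ 2) n \<noteq> 0" for n using t by (simp add: wt_def)
  have per: "c (n + 3) = c n" for n
  proof -
    have "wt e (t ^ 2) (n + 3) = (t ^ 3) powi (4 * n + 4 + 2 * int e) * wt e (t ^ 2) n"
      unfolding wt_def power_int_power using t
      by (subst power_int_add[symmetric]) (auto simp: algebra_simps)
    then show ?thesis using t by (simp add: c_def theta3_add_3)
  qed
  have refl: "c (1 - int e - n) = c n" for n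
  proof -
    have "wt e (t ^ 2) (1 - int e - n) = wt e (t ^ 2) n" by (simp add: wt_def algebra_simps)
    then show ?thesis using t by (simp add: c_def theta3_reflect)
  qed
  have "c n = (if fixed_class e n then c (int e - 1) else c (int e))"
  proof -
    define k where "k = (n - int e) div 3"
    have "(n - int e) mod 3 = 0 \<or> (n - int e) mod 3 = 1 \<or> (n - int e) mod 3 = 2" by presburger
    then consider "n = int e + 3 * k" | "n = int e + 1 + 3 * k" | "n = int e - 1 + 3 * (k + 1)"
      unfolding k_def using div_mult_mod_eq[of "n - int e" 3] by fastforce
    then show ?thesis
    proof cases
      case 1
      then have "\<not> fixed_class e n" unfolding fixed_class_def by presburger
      then show ?thesis using periodic_int[of c, OF per] 1 by simp
    next
      case 2
      then have "\<not> fixed_class e n" unfolding fixed_class_def by presburger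
      moreover have "n = 1 - int e - int e + 3 * (int e + k)" using 2 by simp
      then have "c n = c (1 - int e - int e)" by (simp only: periodic_int[of c, OF per])
      ultimately show ?thesis using refl[of "int e"] by simp
    next
      case 3
      then have "fixed_class e n" unfolding fixed_class_def by presburger
      moreover have "c n = c (int e - 1)" unfolding 3 by (rule periodic_int[of c, OF per])
      ultimately show ?thesis by simp
    qed
  qed
  moreover have "theta3 e (t ^ 3) n = c n * wt e (t ^ 2) n" using wt_nz by (simp add: c_def)
  ultimately show ?thesis by (simp add: wt_on_def)
qed

section \<open>Summability and linearity of the two functionals on class weights\<close>

lemma wt_on_bound:
  assumes u: "u \<noteq> 0" "norm u < 1" and e: "e \<le> 1"
  shows "norm (wt_on P e u n) \<le> sqrt (norm u) powi (- 2) * sqrt (norm u) ^ nat \<bar>n\<bar>"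
proof (cases "P n")
  case True
  have "norm (wt e u n) \<le> sqrt (norm u) powi (- 2) * sqrt (norm u) ^ nat \<bar>n\<bar>"
    unfolding wt_def
  proof (rule norm_powi_bound[OF u])
    have "(1 - int e) * n \<le> \<bar>n\<bar>"
      using e by (cases "e = 0") (auto simp: le_Suc_eq)
    then show "\<bar>n\<bar> \<le> 2 * (n * n - (1 - int e) * n) + 2"
      using int_square_ge[of n] by (simp add: right_diff_distrib)
  qed simp
  then show ?thesis using True by (simp add: wt_on_def)
next
  case False
  then show ?thesis by (simp add: wt_on_def)
qed

lemma U_sum_summable:
  assumes u: "u \<noteq> 0" "norm u < 1" and e: "e \<le> 1"
  shows "(\<lambda>(i, j). fps_nth (dil ((u ^ 3) ^ e) (qG (u ^ 3))) i * qinv ((u ^ 3)\<^sup>2) j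
    * wt_on P e u (int i + 2 * int j)) summable_on UNIV"
proof -
  have s: "norm (u ^ 3) < 1" using norm_power_Suc_less_1[OF u(2), of 2] by (simp add: numeral_3_eq_3)
  obtain C where C: "\<And>i. norm (fps_nth (dil ((u ^ 3) ^ e) (qG (u ^ 3))) i) \<le> C"
    using U_coeff_bounded[OF s] by blast
  obtain D where D: "\<And>j. norm (qinv ((u ^ 3)\<^sup>2) j) \<le> D"
    using qinv_bounded[OF norm_power2_less_1[OF s]] by blast
  have d: "0 \<le> sqrt (norm u)" "sqrt (norm u) < 1" using u by auto
  show ?thesis
    by (rule summable_on_decaying[OF d C D wt_on_bound[OF u e]]) simp
qed

text \<open>The weight alone does not decay along \<open>i = j\<close>; the factor with exponent
  quadratic in \<open>j\<close> has to be included in the estimate.\<close>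

lemma V_sum_summable:
  assumes u: "u \<noteq> 0" "norm u < 1" and e: "e \<le> 1"
  shows "(\<lambda>(i, j). (u ^ 3) powi (int e * int i + int j * int j + (1 - int e) * int j)
     * qinv ((u ^ 3)\<^sup>2) i * qinv ((u ^ 3)\<^sup>2) j * wt_on P e u (int i - int j)) summable_on UNIV"
    (is "(\<lambda>(i, j). ?f i j) summable_on UNIV")
proof -
  have s: "norm (u ^ 3) < 1" using norm_power_Suc_less_1[OF u(2), of 2] by (simp add: numeral_3_eq_3)
  obtain D where D: "\<And>j. norm (qinv ((u ^ 3)\<^sup>2) j) \<le> D" "D > 0"
    using qinv_bounded[OF norm_power2_less_1[OF s]] by blast
  define E where "E = (\<lambda>i j. 3 * (int e * int i + int j * int j + (1 - int e) * int j)
      + ((int i - int j) * (int i - int j) - (1 - int e) * (int i - int j)))"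
  show ?thesis
  proof (rule summable_on_powi_bound[OF u, where u = "\<lambda>(i, j). int i" and v = "\<lambda>(i, j). int j" and w = "\<lambda>_. 0"
        and C = "D * D" and E = "\<lambda>(i, j). E i j"])
    fix x :: "nat \<times> nat"
    obtain i j where x: "x = (i, j)" by force
    have "norm (wt_on P e u (int i - int j)) \<le> norm (wt e u (int i - int j))" by (simp add: wt_on_def)
    then have "norm (?f i j) \<le> norm ((u ^ 3) powi (int e * int i + int j * int j + (1 - int e) * int j))
        * D * D * norm (wt e u (int i - int j))"
      unfolding norm_mult using D by (intro mult_mono) auto
    also have "\<dots> = D * D * norm ((u ^ 3) powi (int e * int i + int j * int j + (1 - int e) * int j) * wt e u (int i - int j))"
      by (simp add: norm_mult)
    also have "(u ^ 3) powi (int e * int i + int j * int j + (1 - int e) * int j) * wt e u (int i - int j) = u powi E i j"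
      unfolding wt_def E_def power_int_power using u by (subst power_int_add[symmetric]) auto
    finally show "norm (case x of (i, j) \<Rightarrow> ?f i j) \<le> D * D * norm (u powi (case x of (i, j) \<Rightarrow> E i j))"
      by (simp add: x)
    have weaken: "k + l \<le> 2 * (3 * (a + m + b) + (w - y)) + 8"
      if "y \<le> z" "0 \<le> a" "0 \<le> b" "2 * l \<le> m + 1" "2 * z \<le> w + 1" "k - l \<le> z" "0 \<le> l" "0 \<le> z"
      for k l a b m w y z :: int
      unfolding distrib_left right_diff_distrib using that by linarith
    have "int i + int j \<le> 2 * E i j + 8"
      unfolding E_def
    proof (rule weaken)
      show "(1 - int e) * (int i - int j) \<le> \<bar>int i - int j\<bar>" using e by (auto simp: le_Suc_eq)
      show "2 * int j \<le> int j * int j + 1" using int_square_ge[of "int j"] by simp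
      show "2 * \<bar>int i - int j\<bar> \<le> (int i - int j) * (int i - int j) + 1" by (rule int_square_ge)
    qed (use e in auto)
    then show "\<bar>case x of (i, j) \<Rightarrow> int i\<bar> + \<bar>case x of (i, j) \<Rightarrow> int j\<bar> + \<bar>0\<bar> \<le> 2 * (case x of (i, j) \<Rightarrow> E i j) + 8"
      by (simp add: x)
  qed (use D in \<open>auto simp: inj_on_def\<close>)
qed

lemma infsum_linear2:
  fixes f g :: "'a \<Rightarrow> complex"
  assumes "f summable_on A" "g summable_on A"
  shows "infsum (\<lambda>x. c * f x + d * g x) A = c * infsum f A + d * infsum g A"
  using assms by (simp add: infsum_add summable_on_cmult_right infsum_cmult_right)

lemma U_sum_linear:
  assumes u: "u \<noteq> 0" "norm u < 1" and e: "e \<le> 1"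
  shows "U_sum e (u ^ 3) (\<lambda>n. c * wt_on P e u n + d * wt_on Q e u n)
    = c * U_sum e (u ^ 3) (wt_on P e u) + d * U_sum e (u ^ 3) (wt_on Q e u)"
  unfolding U_sum_def infsum_linear2[OF U_sum_summable[OF assms] U_sum_summable[OF assms], symmetric]
  by (intro infsum_cong) (auto simp: algebra_simps)

lemma V_sum_linear:
  assumes u: "u \<noteq> 0" "norm u < 1" and e: "e \<le> 1"
  shows "V_sum e (u ^ 3) (\<lambda>n. c * wt_on P e u n + d * wt_on Q e u n)
    = c * V_sum e (u ^ 3) (wt_on P e u) + d * V_sum e (u ^ 3) (wt_on Q e u)"
  unfolding V_sum_def infsum_linear2[OF V_sum_summable[OF assms] V_sum_summable[OF assms], symmetric]
  by (intro infsum_cong) (auto simp: algebra_simps)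

section \<open>Changing the sign of the square root \<open>u\<close>\<close>

lemma power_int_minus_base: "(- x :: complex) powi n = (if even n then x powi n else - (x powi n))"
  by (cases "even n") auto

lemma wt_on_minus:
  assumes "e \<le> 1"
  shows "wt_on P e (- u) n = (if e = 1 \<and> odd n then - wt_on P e u n else wt_on P e u n)"
  using assms by (auto simp: wt_on_def wt_def power_int_minus_base le_Suc_eq)

text \<open>For \<open>e = 1\<close> the coefficient and the weight both acquire the sign
  \<open>(-1)^i\<close>, and for \<open>e = 0\<close> neither changes. Class sums thus depend only
  on \<open>u^2\<close>, unlike the theta coefficients multiplying them.\<close>

lemma U_sum_minus:
  assumes e: "e \<le> 1"
  shows "U_sum e ((- u) ^ 3) (wt_on P e (- u)) = U_sum e (u ^ 3) (wt_on P e u)"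
  unfolding U_sum_def
proof (rule infsum_cong, clarify)
  fix i j :: nat
  have "even (i * (i - 1))" by (cases i) auto
  then have "(- (u ^ 3)) ^ (i * (i - 1)) = (u ^ 3) ^ (i * (i - 1))" by simp
  moreover have "e = 0 \<or> e = 1" using e by auto
  ultimately show "fps_nth (dil (((- u) ^ 3) ^ e) (qG ((- u) ^ 3))) i * qinv (((- u) ^ 3)\<^sup>2) j * wt_on P e (- u) (int i + 2 * int j)
    = fps_nth (dil ((u ^ 3) ^ e) (qG (u ^ 3))) i * qinv ((u ^ 3)\<^sup>2) j * wt_on P e u (int i + 2 * int j)"
    by (cases "even i") (auto simp: wt_on_minus)
qed

lemma V_sum_minus:
  assumes e: "e \<le> 1"
  shows "V_sum e ((- u) ^ 3) (wt_on P e (- u)) = V_sum e (u ^ 3) (wt_on P e u)"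
  unfolding V_sum_def
proof (rule infsum_cong, clarify)
  fix i j :: nat
  have "e = 0 \<or> e = 1" using e by auto
  then show "((- u) ^ 3) powi (int e * int i + int j * int j + (1 - int e) * int j) * qinv (((- u) ^ 3)\<^sup>2) i
      * qinv (((- u) ^ 3)\<^sup>2) j * wt_on P e (- u) (int i - int j)
    = (u ^ 3) powi (int e * int i + int j * int j + (1 - int e) * int j) * qinv ((u ^ 3)\<^sup>2) i
      * qinv ((u ^ 3)\<^sup>2) j * wt_on P e u (int i - int j)"
    by (cases "even i"; cases "even j") (auto simp: wt_on_minus power_int_minus_base)
qed

text \<open>The generating function of a class weight at \<open>z = g u^(3(1-e))\<close>, which is
  \<open>g r^(2(1-e))\<close> when \<open>u = t^2\<close> and \<open>r = t^3\<close>. At this point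
  the first factor of the generating function of \<open>theta3\<close> has the symmetric exponent
  \<open>2(a^2 + a)\<close>.\<close>

definition wt_theta :: "complex \<Rightarrow> (int \<Rightarrow> bool) \<Rightarrow> nat \<Rightarrow> complex \<Rightarrow> complex" where
  "wt_theta g P e u = (\<Sum>\<^sub>\<infinity>n. wt_on P e u n * (g powi n * u powi (3 * (1 - int e) * n)))"

lemma wt_theta_summable:
  assumes u: "u \<noteq> 0" "norm u < 1" and e: "e \<le> 1" and g: "norm g = 1"
  shows "(\<lambda>n. wt_on P e u n * (g powi n * u powi (3 * (1 - int e) * n))) summable_on UNIV"
proof (rule summable_on_powi_bound[OF u, where u = "\<lambda>n. n" and v = "\<lambda>_. 0" and w = "\<lambda>_. 0" and C = 1
    and E = "\<lambda>n. n * n + 2 * (1 - int e) * n"])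
  fix n :: int
  have "norm (wt e u n * (g powi n * u powi (3 * (1 - int e) * n))) = norm (wt e u n * u powi (3 * (1 - int e) * n))"
    using g by (simp add: norm_mult norm_power_int)
  also have "wt e u n * u powi (3 * (1 - int e) * n) = u powi (n * n + 2 * (1 - int e) * n)"
    unfolding wt_def using u by (subst power_int_add[symmetric]) (auto simp: algebra_simps)
  finally show "norm (wt_on P e u n * (g powi n * u powi (3 * (1 - int e) * n))) \<le> 1 * norm (u powi (n * n + 2 * (1 - int e) * n))"
    by (simp add: wt_on_def)
  \<comment> \<open>The linear term can cost \<open>4|n|\<close>, which uses up all that
    \<open>int_square_ge\<close> would give; centring the square at 2 leaves decay in
    \<open>|n|\<close>.\<close>
  have "0 \<le> (\<bar>n\<bar> - 2) * (\<bar>n\<bar> - 2)" by simp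
  then have "4 * \<bar>n\<bar> \<le> n * n + 4" by (simp add: algebra_simps)
  moreover have "- \<bar>n\<bar> \<le> (1 - int e) * n" using e by (auto simp: le_Suc_eq)
  moreover have "2 * (n * n + 2 * (1 - int e) * n) = 2 * (n * n) + 4 * ((1 - int e) * n)" by simp
  moreover have "z \<le> y + 8" if "4 * z \<le> w + 4" "- z \<le> v" "y = 2 * w + 4 * v" "0 \<le> z" for v w y z :: int
    using that by linarith
  ultimately show "\<bar>n\<bar> + \<bar>0\<bar> + \<bar>0\<bar> \<le> 2 * (n * n + 2 * (1 - int e) * n) + 8"
    by (metis abs_ge_zero abs_zero add_0_right)
qed (auto simp: inj_on_def)

text \<open>The sign \<open>(-1)^n\<close> comes from the weight when \<open>e = 1\<close> and from
  the evaluation point when \<open>e = 0\<close>.\<close>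

lemma wt_theta_minus:
  assumes e: "e \<le> 1"
  shows "wt_theta 1 P e (- u) = wt_theta (- 1) P e u"
  unfolding wt_theta_def
proof (rule infsum_cong)
  fix n
  have "e = 0 \<or> e = 1" using e by auto
  then show "wt_on P e (- u) n * (1 powi n * (- u) powi (3 * (1 - int e) * n))
      = wt_on P e u n * ((- 1) powi n * u powi (3 * (1 - int e) * n))"
    by (cases "even n") (auto simp: wt_on_minus power_int_minus_base)
qed

text \<open>The weight is a convolution of two theta sequences, so its generating function is the
  product of theirs.\<close>

lemma theta3_generating:
  assumes r: "r \<noteq> 0" "norm r < 1" and e: "e \<le> 1" and g: "g = 1 \<or> g = (- 1 :: complex)"
  shows "(\<Sum>\<^sub>\<infinity>n. theta3 e r n * (g powi n * r powi (2 * (1 - int e) * n)))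
    = (\<Sum>\<^sub>\<infinity>a. g powi a * r powi (2 * (a * a + a))) * (\<Sum>\<^sub>\<infinity>b. g powi b * r powi (b * b - b + 2 * (1 - int e) * b))"
proof -
  define f1 f2 where "f1 = (\<lambda>a. g powi a * r powi (2 * (a * a + a)))"
    and "f2 = (\<lambda>b. g powi b * r powi (b * b - b + 2 * (1 - int e) * b))"
  have g0: "g \<noteq> 0" "norm g = 1" using g by auto
  have summ: "(\<lambda>(n, a). f1 a * f2 (n - a)) summable_on UNIV \<times> UNIV"
  proof (rule summable_on_powi_bound[OF r, where u = "\<lambda>(n, a). a" and v = "\<lambda>(n, a). n - a" and w = "\<lambda>_. 0" and C = 1
      and E = "\<lambda>(n, a). 2 * (a * a + a) + ((n - a) * (n - a) - (n - a) + 2 * (1 - int e) * (n - a))"])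
    fix x :: "int \<times> int"
    obtain n a where x: "x = (n, a)" by force
    have "norm (f1 a * f2 (n - a)) = norm (r powi (2 * (a * a + a)) * r powi ((n - a) * (n - a) - (n - a) + 2 * (1 - int e) * (n - a)))"
      using g0 by (simp add: f1_def f2_def norm_mult norm_power_int)
    also have "r powi (2 * (a * a + a)) * r powi ((n - a) * (n - a) - (n - a) + 2 * (1 - int e) * (n - a))
        = r powi (2 * (a * a + a) + ((n - a) * (n - a) - (n - a) + 2 * (1 - int e) * (n - a)))"
      using r(1) by (simp only: power_int_add simp_thms)
    finally show "norm (case x of (n, a) \<Rightarrow> f1 a * f2 (n - a)) \<le> 1 * norm (r powi (case x of (n, a) \<Rightarrow>
        2 * (a * a + a) + ((n - a) * (n - a) - (n - a) + 2 * (1 - int e) * (n - a))))"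
      by (simp only: x prod.case mult_1_left order_refl)
    define b where "b = n - a"
    have "e = 0 \<or> e = 1" using e by auto
    then have "- \<bar>b\<bar> \<le> - b + 2 * (1 - int e) * b" by auto
    then have "\<bar>a\<bar> + \<bar>b\<bar> \<le> 2 * (2 * (a * a + a) + (b * b - b + 2 * (1 - int e) * b)) + 6"
      using int_square_ge[of a] int_square_ge[of b] abs_ge_minus_self[of a] abs_ge_zero[of b]
      by (simp add: distrib_left right_diff_distrib)
    then show "\<bar>case x of (n, a) \<Rightarrow> a\<bar> + \<bar>case x of (n, a) \<Rightarrow> n - a\<bar> + \<bar>0\<bar> \<le> 2 * (case x of (n, a) \<Rightarrow>
        2 * (a * a + a) + ((n - a) * (n - a) - (n - a) + 2 * (1 - int e) * (n - a))) + 6"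
      by (simp add: x b_def)
  qed (auto simp: inj_on_def)
  have "(\<Sum>\<^sub>\<infinity>n. theta3 e r n * (g powi n * r powi (2 * (1 - int e) * n))) = (\<Sum>\<^sub>\<infinity>n. \<Sum>\<^sub>\<infinity>a. f1 a * f2 (n - a))"
    unfolding theta3_def infsum_cmult_left'[symmetric]
  proof (intro infsum_cong)
    fix n a
    have "theta_term e r a (n - a) * r powi (2 * (1 - int e) * n)
        = r powi (2 * (a * a + a)) * r powi ((n - a) * (n - a) - (n - a) + 2 * (1 - int e) * (n - a))"
      unfolding theta_term_def using r(1)
      by (simp only: power_int_add[symmetric] simp_thms) (simp add: algebra_simps)
    moreover have "g powi n = g powi a * g powi (n - a)"
      using g0(1) by (subst power_int_add[symmetric]) auto
    ultimately show "theta_term e r a (n - a) * (g powi n * r powi (2 * (1 - int e) * n)) = f1 a * f2 (n - a)"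
      by (simp add: f1_def f2_def mult_ac)
  qed
  also have "\<dots> = (\<Sum>\<^sub>\<infinity>a. \<Sum>\<^sub>\<infinity>n. f1 a * f2 (n - a))"
    by (rule infsum_swap_banach[OF summ])
  also have "\<dots> = (\<Sum>\<^sub>\<infinity>a. f1 a * infsum f2 UNIV)"
  proof (rule infsum_cong)
    fix a
    have "(\<Sum>\<^sub>\<infinity>n. f2 (n - a)) = infsum f2 UNIV" using infsum_int_shift[of f2 "- a"] by simp
    then show "(\<Sum>\<^sub>\<infinity>n. f1 a * f2 (n - a)) = f1 a * infsum f2 UNIV" by (simp add: infsum_cmult_right')
  qed
  finally show ?thesis by (simp add: infsum_cmult_left' f1_def f2_def)
qed

text \<open>The reflection \<open>a -> - 1 - a\<close> preserves \<open>a^2 + a\<close> but reverses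
  the sign \<open>(-1)^a\<close>, so the first factor cancels against itself.\<close>

lemma theta3_generating_zero:
  assumes r: "r \<noteq> 0" "norm r < 1" and e: "e \<le> 1"
  shows "(\<Sum>\<^sub>\<infinity>n. theta3 e r n * ((- 1) powi n * r powi (2 * (1 - int e) * n))) = 0"
proof -
  define S where "S = (\<Sum>\<^sub>\<infinity>a::int. (- 1 :: complex) powi a * r powi (2 * (a * a + a)))"
  have "S = (\<Sum>\<^sub>\<infinity>a. - ((- 1) powi a * r powi (2 * (a * a + a))))"
    unfolding S_def
    by (subst infsum_int_reflect[symmetric, of _ "- 1"], intro infsum_cong)
       (auto simp: power_int_minus_base algebra_simps)
  also have "\<dots> = - S" unfolding S_def by (rule infsum_uminus)
  finally have "S = 0" by simp
  then show ?thesis using theta3_generating[OF r e, of "- 1"] by (simp add: S_def)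
qed

text \<open>For \<open>g = 1\<close> the two factors are \<open>theta2 (r^2)\<close> and
  \<open>theta2 r\<close>, both nonzero by Gauss's product.\<close>

lemma theta3_generating_nonzero:
  assumes r: "r \<noteq> 0" "norm r < 1" and e: "e \<le> 1"
  shows "(\<Sum>\<^sub>\<infinity>n. theta3 e r n * (1 powi n * r powi (2 * (1 - int e) * n))) \<noteq> 0"
proof -
  have s: "r\<^sup>2 \<noteq> 0" "norm (r\<^sup>2) < 1" using r norm_power2_less_1[of r] by auto
  have "(r\<^sup>2) powi n = r powi (2 * n)" for n by (simp add: power_int_mult)
  then have "(\<Sum>\<^sub>\<infinity>a::int. r powi (2 * (a * a + a))) = (\<Sum>\<^sub>\<infinity>a. (r\<^sup>2) powi (a * a - a))"
    by (subst infsum_int_reflect[symmetric, of _ 0]) simp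
  then have 1: "(\<Sum>\<^sub>\<infinity>a::int. r powi (2 * (a * a + a))) = theta2 (r\<^sup>2)" by (simp add: theta2_def)
  have "(\<Sum>\<^sub>\<infinity>b::int. r powi (b * b - b + 2 * b)) = (\<Sum>\<^sub>\<infinity>b. r powi (b * b - b))"
    by (subst infsum_int_reflect[symmetric, of _ 0]) simp
  then have 2: "(\<Sum>\<^sub>\<infinity>b::int. r powi (b * b - b + 2 * (1 - int e) * b)) = theta2 r"
    using e by (auto simp: theta2_def le_Suc_eq)
  show ?thesis
    using theta3_generating[OF r e, of 1] 1 2 theta2_nonzero[OF r] theta2_nonzero[OF s] by simp
qed

text \<open>The nonzero row \<open>c\<close> annihilates \<open>W\<close> while the row
  \<open>d\<close> does not, so the rows are independent and their determinant \<open>m\<close> is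
  nonzero. Cramer's rule then gives \<open>D = 0\<close>.\<close>

lemma proportional_pairs_vanish:
  fixes D1 D2 :: complex
  assumes "c1 * D1 + c2 * D2 = 0" "d1 * D1 + d2 * D2 = 0"
    and W: "c1 * W1 + c2 * W2 = 0" "d1 * W1 + d2 * W2 \<noteq> 0" and c: "c1 \<noteq> 0 \<or> c2 \<noteq> 0"
  shows "D1 = 0 \<and> D2 = 0"
proof -
  define m where "m = c1 * d2 - c2 * d1"
  have "c1 * (d1 * W1 + d2 * W2) = d1 * (c1 * W1 + c2 * W2) + m * W2"
    "c2 * (d1 * W1 + d2 * W2) = d2 * (c1 * W1 + c2 * W2) - m * W1"
    by (simp_all add: m_def algebra_simps)
  then have "m \<noteq> 0" using W c by auto
  moreover have "m * D1 = d2 * (c1 * D1 + c2 * D2) - c2 * (d1 * D1 + d2 * D2)"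
    "m * D2 = c1 * (d1 * D1 + d2 * D2) - d1 * (c1 * D1 + c2 * D2)"
    by (simp_all add: m_def algebra_simps)
  ultimately show ?thesis unfolding assms(1,2) by simp
qed

text \<open>Passing from \<open>u\<close> to \<open>- u\<close> fixes the class sums but changes the theta coefficients, which gives a
  second linear relation between the two class sums.\<close>

lemma U_sum_eq_V_sum:
  assumes u: "u \<noteq> 0" "norm u < 1" and e: "e \<le> 1"
  shows "qpoch_inf (- ((u ^ 3)\<^sup>2)) ((u ^ 3)\<^sup>2) * U_sum e (u ^ 3) (wt e u) = V_sum e (u ^ 3) (wt e u)"
proof -
  let ?P = "fixed_class e" and ?Q = "\<lambda>n. \<not> fixed_class e n"
  define N where "N = qpoch_inf (- ((u ^ 3)\<^sup>2)) ((u ^ 3)\<^sup>2)"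
  define D where "D = (\<lambda>P. N * U_sum e (u ^ 3) (wt_on P e u) - V_sum e (u ^ 3) (wt_on P e u))"
  define c where "c = (\<lambda>t n. theta3 e (t ^ 3) n / wt e (t ^ 2) n)"
  \<comment> \<open>Stated for a square root \<open>t\<close> of either \<open>u\<close> or
    \<open>- u\<close>. In both cases the class sums and \<open>N\<close> are those of
    \<open>u\<close>; only the coefficients \<open>c t\<close> differ.\<close>
  have main: "c t (int e - 1) * D ?P + c t (int e) * D ?Q = 0"
    and gen: "\<And>g. g = 1 \<or> g = - 1 \<Longrightarrow>
      c t (int e - 1) * wt_theta g ?P e (t ^ 2) + c t (int e) * wt_theta g ?Q e (t ^ 2)
      = (\<Sum>\<^sub>\<infinity>n. theta3 e (t ^ 3) n * (g powi n * (t ^ 3) powi (2 * (1 - int e) * n)))"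
    and t0: "t ^ 3 \<noteq> 0" "norm (t ^ 3) < 1"
    if t: "t ^ 2 = u \<or> t ^ 2 = - u" for t
  proof -
    show t0: "t ^ 3 \<noteq> 0" using t u by auto
    have nt: "norm (t ^ 2) < 1" using t u by auto
    have "norm t < 1"
    proof (rule ccontr)
      assume "\<not> norm t < 1"
      then have "1 \<le> norm t ^ 2" by (intro one_le_power) simp
      then show False using nt by (simp add: norm_power)
    qed
    then show t1: "norm (t ^ 3) < 1" using norm_power_Suc_less_1[of t 2] by (simp add: numeral_3_eq_3)
    have u': "t ^ 2 \<noteq> 0" "norm (t ^ 2) < 1" using t0 nt by auto
    have s: "(t ^ 3)\<^sup>2 = (t ^ 2) ^ 3" by (simp flip: power_mult)
    have classes: "theta3 e (t ^ 3) = (\<lambda>n. c t (int e - 1) * wt_on ?P e (t ^ 2) n + c t (int e) * wt_on ?Q e (t ^ 2) n)"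
      unfolding c_def by (rule ext, rule theta3_classes) (use t0 in auto)
    have "((- u) ^ 3)\<^sup>2 = (u ^ 3)\<^sup>2" by simp
    with t have "((t ^ 2) ^ 3)\<^sup>2 = (u ^ 3)\<^sup>2" by (elim disjE) (simp_all only:)
    then have "N * U_sum e ((t ^ 2) ^ 3) (theta3 e (t ^ 3)) = V_sum e ((t ^ 2) ^ 3) (theta3 e (t ^ 3))"
      using theta3_identity[OF t0 t1 e] by (simp add: N_def s)
    moreover have "U_sum e ((t ^ 2) ^ 3) (wt_on P e (t ^ 2)) = U_sum e (u ^ 3) (wt_on P e u)"
      "V_sum e ((t ^ 2) ^ 3) (wt_on P e (t ^ 2)) = V_sum e (u ^ 3) (wt_on P e u)" for P
      using t by (elim disjE; simp only: U_sum_minus[OF e] V_sum_minus[OF e])+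
    ultimately show "c t (int e - 1) * D ?P + c t (int e) * D ?Q = 0"
      unfolding classes U_sum_linear[OF u' e] V_sum_linear[OF u' e]
      by (simp add: D_def algebra_simps)
    fix g :: complex assume g: "g = 1 \<or> g = - 1"
    have g1: "norm g = 1" using g by auto
    have exp_eq: "(t ^ 3) powi (2 * (1 - int e) * n) = (t ^ 2) powi (3 * (1 - int e) * n)" for n
      unfolding power_int_power by (simp add: mult_ac)
    show "c t (int e - 1) * wt_theta g ?P e (t ^ 2) + c t (int e) * wt_theta g ?Q e (t ^ 2)
      = (\<Sum>\<^sub>\<infinity>n. theta3 e (t ^ 3) n * (g powi n * (t ^ 3) powi (2 * (1 - int e) * n)))"
      unfolding wt_theta_def
        infsum_linear2[OF wt_theta_summable[OF u' e g1] wt_theta_summable[OF u' e g1], symmetric]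
      unfolding classes exp_eq by (intro infsum_cong) (simp add: distrib_right mult.assoc)
  qed
  define t where "t = csqrt u"
  define t' where "t' = csqrt (- u)"
  have t: "t ^ 2 = u" and t': "t' ^ 2 = - u" by (simp_all add: t_def t'_def)
  have "c t (int e - 1) * wt_theta 1 ?P e u + c t (int e) * wt_theta 1 ?Q e u \<noteq> 0"
    using gen[of t 1] theta3_generating_nonzero[OF t0[of t] e] t by simp
  then have cnz: "c t (int e - 1) \<noteq> 0 \<or> c t (int e) \<noteq> 0" by auto
  \<comment> \<open>The pair of class generating functions at \<open>g = -1\<close> plays the role
    of \<open>W\<close>. It is annihilated by the coefficients from \<open>t\<close>.\<close>
  have Wt: "c t (int e - 1) * wt_theta (- 1) ?P e u + c t (int e) * wt_theta (- 1) ?Q e u = 0"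
    using gen[of t "- 1"] theta3_generating_zero[OF t0[of t] e] t by simp
  \<comment> \<open>For \<open>- u\<close> the point \<open>g = 1\<close> is the point
    \<open>g = -1\<close> for \<open>u\<close>, so the same pair is not annihilated by the
    coefficients from \<open>t'\<close>.\<close>
  have Wt': "c t' (int e - 1) * wt_theta (- 1) ?P e u + c t' (int e) * wt_theta (- 1) ?Q e u \<noteq> 0"
    using gen[of t' 1] theta3_generating_nonzero[OF t0[of t'] e] t' by (simp add: wt_theta_minus[OF e])
  have "D ?P = 0 \<and> D ?Q = 0"
    by (rule proportional_pairs_vanish[OF main main Wt Wt' cnz]) (use t t' in auto)
  moreover have split: "wt e u = (\<lambda>n. 1 * wt_on ?P e u n + 1 * wt_on ?Q e u n)"
    by (auto simp: wt_on_def)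
  ultimately show ?thesis
    unfolding N_def[symmetric] split U_sum_linear[OF u e] V_sum_linear[OF u e]
    by (simp add: D_def distrib_left)
qed

subsection \<open>The four double sums\<close>

text \<open>With \<open>n = i + 2 j\<close>, the exponent
  \<open>3(i^2 - (1-e) i) + n^2 - (1-e) n\<close> is twice that of \<open>S3\<close> for
  \<open>e = 0\<close> and twice that of \<open>S4\<close> for \<open>e = 1\<close>.\<close>

lemma U_sum_term:
  assumes u: "u \<noteq> 0" and e: "e \<le> 1"
  shows "fps_nth (dil ((u ^ 3) ^ e) (qG (u ^ 3))) i * qinv ((u ^ 3)\<^sup>2) j * wt e u (int i + 2 * int j)
    = u powi (3 * (int i * int i - (1 - int e) * int i) + (int i + 2 * int j) * (int i + 2 * int j)
        - (1 - int e) * (int i + 2 * int j)) * (qinv ((u\<^sup>2) ^ 3) i * qinv ((u\<^sup>2) ^ 3) j)"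
proof -
  have p: "(u ^ 3)\<^sup>2 = (u\<^sup>2) ^ 3" by (simp flip: power_mult)
  have "int (3 * e * i + 3 * (i * (i - 1))) = 3 * (int i * int i - (1 - int e) * int i)"
    by (cases i) (simp_all add: algebra_simps)
  moreover have "((u ^ 3) ^ e) ^ i * (u ^ 3) ^ (i * (i - 1)) = u powi int (3 * e * i + 3 * (i * (i - 1)))"
    by (simp only: power_int_of_nat power_add power_mult)
  ultimately have coeff: "((u ^ 3) ^ e) ^ i * (u ^ 3) ^ (i * (i - 1))
      = u powi (3 * (int i * int i - (1 - int e) * int i))" by (simp only:)
  have weight: "u powi (3 * (int i * int i - (1 - int e) * int i)) * wt e u (int i + 2 * int j)
      = u powi (3 * (int i * int i - (1 - int e) * int i) + (int i + 2 * int j) * (int i + 2 * int j)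
        - (1 - int e) * (int i + 2 * int j))"
    unfolding wt_def using u by (subst power_int_add[symmetric]) (auto simp: algebra_simps)
  show ?thesis unfolding p dil_nth qG_nth weight[symmetric] coeff[symmetric] by (simp only: mult_ac)
qed

lemma V_sum_term:
  assumes u: "u \<noteq> 0"
  shows "(u ^ 3) powi (int e * int i + int j * int j + (1 - int e) * int j) * qinv ((u ^ 3)\<^sup>2) i
      * qinv ((u ^ 3)\<^sup>2) j * wt e u (int i - int j)
    = u powi (3 * (int e * int i + int j * int j + (1 - int e) * int j) + (int i - int j) * (int i - int j)
        - (1 - int e) * (int i - int j)) * (qinv ((u\<^sup>2) ^ 3) i * qinv ((u\<^sup>2) ^ 3) j)"
proof -
  have p: "(u ^ 3)\<^sup>2 = (u\<^sup>2) ^ 3" by (simp flip: power_mult)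
  have weight: "(u ^ 3) powi (int e * int i + int j * int j + (1 - int e) * int j) * wt e u (int i - int j)
      = u powi (3 * (int e * int i + int j * int j + (1 - int e) * int j) + (int i - int j) * (int i - int j)
        - (1 - int e) * (int i - int j))"
    unfolding wt_def power_int_power using u by (subst power_int_add[symmetric]) (auto simp: algebra_simps)
  show ?thesis unfolding p weight[symmetric] by (simp only: mult_ac)
qed

lemma double_sum_term:
  "(u\<^sup>2) powi k / (qpoch ((u\<^sup>2) ^ 3) ((u\<^sup>2) ^ 3) i * qpoch ((u\<^sup>2) ^ 3) ((u\<^sup>2) ^ 3) j)
    = u powi (2 * k) * (qinv ((u\<^sup>2) ^ 3) i * qinv ((u\<^sup>2) ^ 3) j)"
  unfolding qinv_def by (simp add: power_int_mult divide_inverse)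

lemma S1_eq_V_sum:
  assumes "u \<noteq> 0"
  shows "S1 (u\<^sup>2) = V_sum 0 (u ^ 3) (wt 0 u)"
  unfolding S1_def V_sum_def V_sum_term[OF assms] double_sum_term
proof (rule infsum_cong, clarify)
  fix i j :: nat
  have "even (int i * int i - int i)" by simp
  then have "2 * ((int i * int i - int i) div 2) = int i * int i - int i" by simp
  then have "2 * ((int i * int i - int i) div 2 - int i * int j + 2 * int j * int j + 2 * int j)
    = 3 * (int 0 * int i + int j * int j + (1 - int 0) * int j) + (int i - int j) * (int i - int j) - (1 - int 0) * (int i - int j)"
    by (simp add: algebra_simps)
  then show "u powi (2 * ((int i * int i - int i) div 2 - int i * int j + 2 * int j * int j + 2 * int j))
      * (qinv ((u\<^sup>2) ^ 3) i * qinv ((u\<^sup>2) ^ 3) j)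
    = u powi (3 * (int 0 * int i + int j * int j + (1 - int 0) * int j) + (int i - int j) * (int i - int j)
        - (1 - int 0) * (int i - int j)) * (qinv ((u\<^sup>2) ^ 3) i * qinv ((u\<^sup>2) ^ 3) j)"
    by (simp only:)
qed

lemma S2_eq_V_sum:
  assumes "u \<noteq> 0"
  shows "S2 (u\<^sup>2) = V_sum 1 (u ^ 3) (wt 1 u)"
  unfolding S2_def V_sum_def V_sum_term[OF assms] double_sum_term
proof (rule infsum_cong, clarify)
  fix i j :: nat
  have "even (int i * int i + 3 * int i)" by simp
  then have "2 * ((int i * int i + 3 * int i) div 2) = int i * int i + 3 * int i" by simp
  then have "2 * ((int i * int i + 3 * int i) div 2 - int i * int j + 2 * int j * int j)
    = 3 * (int 1 * int i + int j * int j + (1 - int 1) * int j) + (int i - int j) * (int i - int j) - (1 - int 1) * (int i - int j)"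
    by (simp add: algebra_simps)
  then show "u powi (2 * ((int i * int i + 3 * int i) div 2 - int i * int j + 2 * int j * int j))
      * (qinv ((u\<^sup>2) ^ 3) i * qinv ((u\<^sup>2) ^ 3) j)
    = u powi (3 * (int 1 * int i + int j * int j + (1 - int 1) * int j) + (int i - int j) * (int i - int j)
        - (1 - int 1) * (int i - int j)) * (qinv ((u\<^sup>2) ^ 3) i * qinv ((u\<^sup>2) ^ 3) j)"
    by (simp only:)
qed

lemma S3_eq_U_sum:
  assumes "u \<noteq> 0"
  shows "S3 (u\<^sup>2) = U_sum 0 (u ^ 3) (wt 0 u)"
  unfolding S3_def U_sum_def U_sum_term[OF assms le0] double_sum_term
  by (intro infsum_cong) (auto simp: algebra_simps)

lemma S4_eq_U_sum:
  assumes "u \<noteq> 0"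
  shows "S4 (u\<^sup>2) = U_sum 1 (u ^ 3) (wt 1 u)"
  unfolding S4_def U_sum_def U_sum_term[OF assms order_refl] double_sum_term
  by (intro infsum_cong) (auto simp: algebra_simps)

section \<open>The case \<open>q = 0\<close>\<close>

lemma qpoch_0_0 [simp]: "qpoch 0 0 n = 1"
  by (simp add: qpoch_def)

lemma qpoch_inf_0_0 [simp]: "qpoch_inf 0 0 = 1"
  by (simp add: qpoch_inf_def)

text \<open>Since \<open>0 powi k\<close> is 1 for \<open>k = 0\<close> and 0 for every other
  integer, the sum counts the zeros of the exponent.\<close>

lemma infsum_powi_zero:
  fixes E :: "nat \<Rightarrow> nat \<Rightarrow> int"
  assumes "finite X" and "\<And>i j. E i j = 0 \<longleftrightarrow> (i, j) \<in> X"
  shows "(\<Sum>\<^sub>\<infinity>(i, j). (0 :: complex) powi E i j) = of_nat (card X)"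
proof -
  have "(\<Sum>\<^sub>\<infinity>(i, j). (0 :: complex) powi E i j) = (\<Sum>\<^sub>\<infinity>x\<in>X. 1)"
    by (rule infsum_cong_neutral) (auto simp: power_int_0_left_if assms(2))
  then show ?thesis using assms(1) by simp
qed

lemma int_consecutive_eq_0: "(n :: int) * n - n = 0 \<longleftrightarrow> n = 0 \<or> n = 1"
proof -
  have "n * n - n = n * (n - 1)" by (simp add: algebra_simps)
  then show ?thesis by simp
qed

lemma int_consecutive_nonneg: "(n :: int) * n - n \<ge> 0"
proof (cases "n \<ge> 1")
  case True
  then have "0 \<le> n * (n - 1)" by simp
  then show ?thesis by (simp add: algebra_simps)
next
  case False
  then have "0 \<le> (- n) * (1 - n)" by (intro mult_nonneg_nonneg) auto
  then show ?thesis by (simp add: algebra_simps)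
qed

lemma S1_0: "S1 0 = 2"
proof -
  have "(int i * int i - int i) div 2 - int i * int j + 2 * int j * int j + 2 * int j = 0
      \<longleftrightarrow> (i, j) \<in> {(0, 0), (1, 0)}" (is "?E = 0 \<longleftrightarrow> _") for i j
  proof
    assume "?E = 0"
    define d where "d = int i - int j"
    have "2 * ((int i * int i - int i) div 2) = int i * int i - int i" by simp
    \<comment> \<open>Doubling the exponent and completing squares in \<open>i - j\<close> leaves a
      sum of nonnegative terms, so each of them vanishes.\<close>
    then have "(d * d - d) + 3 * (int j * int j) + 3 * int j = 2 * ?E" by (simp add: d_def algebra_simps)
    then have "(d * d - d) + 3 * (int j * int j) + 3 * int j = 0" using \<open>?E = 0\<close> by simp
    moreover have "0 \<le> d * d - d" "0 \<le> int j * int j" by (rule int_consecutive_nonneg) simp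
    ultimately have "d * d - d = 0" "j = 0" by linarith+
    then show "(i, j) \<in> {(0, 0), (1, 0)}" by (auto simp: int_consecutive_eq_0 d_def)
  qed auto
  from infsum_powi_zero[OF _ this] show ?thesis by (simp add: S1_def)
qed

lemma S2_0: "S2 0 = 1"
proof -
  have "(int i * int i + 3 * int i) div 2 - int i * int j + 2 * int j * int j = 0
      \<longleftrightarrow> (i, j) \<in> {(0, 0)}" (is "?E = 0 \<longleftrightarrow> _") for i j
  proof
    assume "?E = 0"
    define d where "d = int i - int j"
    have "2 * ((int i * int i + 3 * int i) div 2) = int i * int i + 3 * int i" by simp
    then have "d * d + 3 * int i + 3 * (int j * int j) = 2 * ?E" by (simp add: d_def algebra_simps)
    then have "d * d + 3 * int i + 3 * (int j * int j) = 0" using \<open>?E = 0\<close> by simp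
    moreover have "0 \<le> d * d" "0 \<le> int j * int j" by simp_all
    ultimately have "int j * int j = 0" "i = 0" by linarith+
    then show "(i, j) \<in> {(0, 0)}" by simp
  qed auto
  from infsum_powi_zero[OF _ this] show ?thesis by (simp add: S2_def)
qed

lemma S3_0: "S3 0 = 2"
proof -
  have "2 * int i * int i + 2 * int i * int j + 2 * int j * int j - 2 * int i - int j = 0
      \<longleftrightarrow> (i, j) \<in> {(0, 0), (1, 0)}" (is "?E = 0 \<longleftrightarrow> _") for i j
  proof
    assume "?E = 0"
    \<comment> \<open>The grouping index of \<open>U_sum\<close> again splits the doubled exponent
      into nonnegative parts.\<close>
    define n where "n = int i + 2 * int j"
    have "3 * (int i * int i - int i) + (n * n - n) = 2 * ?E" by (simp add: n_def algebra_simps)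
    then have "3 * (int i * int i - int i) + (n * n - n) = 0" using \<open>?E = 0\<close> by simp
    moreover have "0 \<le> int i * int i - int i" "0 \<le> n * n - n" by (rule int_consecutive_nonneg)+
    moreover have "a = 0 \<and> b = 0" if "3 * a + b = 0" "0 \<le> a" "0 \<le> b" for a b :: int
      using that by linarith
    ultimately have "int i * int i - int i = 0" "n * n - n = 0" by blast+
    then show "(i, j) \<in> {(0, 0), (1, 0)}" unfolding int_consecutive_eq_0 n_def by auto
  qed auto
  from infsum_powi_zero[OF _ this] show ?thesis by (simp add: S3_def)
qed

lemma S4_0: "S4 0 = 1"
proof -
  have "2 * int i * int i + 2 * int i * int j + 2 * int j * int j = 0
      \<longleftrightarrow> (i, j) \<in> {(0, 0)}" (is "?E = 0 \<longleftrightarrow> _") for i j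
  proof
    assume "?E = 0"
    then have "int (2 * (i * i) + 2 * (i * j) + 2 * (j * j)) = 0" by (simp add: mult.assoc)
    then have "2 * (i * i) + 2 * (i * j) + 2 * (j * j) = 0" by (simp only: of_nat_eq_0_iff)
    then show "(i, j) \<in> {(0, 0)}" by simp
  qed auto
  from infsum_powi_zero[OF _ this] show ?thesis by (simp add: S4_def)
qed

theorem theorem1p2:
  fixes q :: complex
  assumes "norm q < 1"
  shows "S1 q = qpoch_inf (- (q^3)) (q^3) * S3 q \<and> S2 q = qpoch_inf (- (q^3)) (q^3) * S4 q"
proof (cases "q = 0")
  case True
  then show ?thesis by (simp add: S1_0 S2_0 S3_0 S4_0)
next
  case False
  \<comment> \<open>The factors \<open>s = u^3\<close> and \<open>wt 1 u n\<close> separately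
    involve odd powers of a square root of \<open>q\<close>; only their combinations in the double
    sums are integral powers of \<open>q\<close>.\<close>
  define u where "u = csqrt q"
  have q: "q = u\<^sup>2" by (simp add: u_def)
  have u: "u \<noteq> 0" "norm u < 1"
    using False assms by (auto simp: u_def norm_csqrt)
  have p: "(u ^ 3)\<^sup>2 = q ^ 3" by (simp add: q flip: power_mult)
  show ?thesis
    using U_sum_eq_V_sum[OF u, of 0] U_sum_eq_V_sum[OF u, of 1] unfolding p
    by (simp add: S1_eq_V_sum S2_eq_V_sum S3_eq_U_sum S4_eq_U_sum u q)
qed

end
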